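(* Let $n\ge2$ be an integer. Let $\mathcal{B}$ be a separable real Banach space with norm $\|\cdot\|$, and let $\mathcal{W}\subset\mathcal{B}$ be a nonempty convex and closed subset. Suppose that for some integer $K\ge1$ and some $R,\rho\ge0$ the following holds: $\sup_{w,w'\in\mathcal{W}}\|w-w'\|\le R$, and there exist fixed $v_1,\dots,v_K\in\mathcal{B}$ with $\|v_1\|=\dots=\|v_K\|=1$ such that for any $w,w'\in\mathcal{W}$, $$\Big\|(w-w')-\sum_{i=1}^Kt_iv_i\Big\|\le\rho\quad\text{for some }t=(t_1,\dots,t_K)\in\mathbb{R}^K\text{ with }\|t\|_1\le R.$$ Let $\mathcal{A}$ be a randomized algorithm with data space $\mathcal{Z}$ taking values in $\mathcal{W}$, and let $\mathcal{Q}_n$ be a resampling distribution on $\mathrm{seq}_{[n]}$ that satisfies the symmetry, nontrivial subsampling, nonpositive covariance and leave-one-out compatibility conditions (with associated distribution $\mathcal{Q}_{n-1}$). Then derandomized bagging, run with base algorithm $\mathcal{A}$ and resampling distribution $\mathcal{Q}_n$, has mean-square stability $\beta^2$ with respect to $\|\cdot\|$ (at sample size $n$), with $$\beta^2:=1.6\left[R\sqrt{\frac{2(1+\eta_n)\log(2K)}{n}\left(\frac{p_{\mathcal{Q}_n}}{1-p_{\mathcal{Q}_n}}+\frac{4\eta_n}{(1-p_{\mathcal{Q}_n})^2}\right)}+R\sqrt{\frac1n\cdot\frac{p_{\mathcal{Q}_n}}{1-p_{\mathcal{Q}_n}}}+2\rho\cdot p_{\mathcal{Q}_n}\right]^2,$$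 where $\eta_n=\frac{H_n-1}{n-H_n}$ and $H_n=1+\frac12+\dots+\frac1n$ is the $n$th harmonic number.
   Context: Randomized algorithm: let $\mathcal{Z}$ be a set (the data space). A randomized algorithm is a map $\mathcal{A}:\bigcup_{n\ge0}\mathcal{Z}^n\times[0,1]\to\mathcal{W}$, $(\mathcal{D},\xi)\mapsto\mathcal{A}(\mathcal{D};\xi)$, such that for each fixed data set $\mathcal{D}$ the map $t\mapsto\mathcal{A}(\mathcal{D};t)$ is measurable (Borel $\sigma$-algebra on $\mathcal{W}$). The seed $\xi$ is drawn from $\mathrm{Uniform}[0,1]$. The algorithm is deterministic if it does not depend on $\xi$. Bags: $\mathrm{seq}_{[n]}=\{(i_1,\dots,i_k):k\ge0,\ i_1,\dots,i_k\in[n]\}$ is the set of finite sequences in $[n]=\{1,\dots,n\}$. For $r=(i_1,\dots,i_k)\in\mathrm{seq}_{[n]}$ and $\mathcal{D}=(Z_1,\dots,Z_n)$, write $\mathcal{D}^r=(Z_{i_1},\dots,Z_{i_k})$; write $i\in r$ if $i$ occurs among the entries of $r$. Conditions on a probability distribution $\mathcal{Q}_n$ on $\mathrm{seq}_{[n]}$: - Symmetry: $\mathcal{Q}_n\{(i_1,\dots,i_m)\}=\mathcal{Q}_n\{(\sigma(i_1),\dots,\sigma(i_m))\}$ for all $m\ge1$, $i_1,\dots,i_m\in[n]$ and permutations $\sigma$ of $[n]$. - Nontrivial subsampling: $p_{\mathcal{Q}_n}<1$, where $p_{\mathcal{Q}_n}=\mathbb{E}_{r\sim\mathcal{Q}_n}\big[\frac1n\sum_{i=1}^n\mathbf{1}\{i\in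 r\}\big]$. - Nonpositive covariance: $\mathrm{Cov}_{r\sim\mathcal{Q}_n}(\mathbf{1}_{i\in r},\mathbf{1}_{j\in r})\le0$ for all $i\ne j\in[n]$. - Leave-one-out compatibility: the corresponding distribution $\mathcal{Q}_{n-1}$ on $\mathrm{seq}_{[n-1]}$ (used for data sets of size $n-1$) equals the distribution of $r\sim\mathcal{Q}_n$ conditional on the event $n\notin r$. Derandomized bagging with base algorithm $\mathcal{A}$ and resampling distribution $\mathcal{Q}_n$: the deterministic algorithm that on $\mathcal{D}\in\mathcal{Z}^n$ returns $\hat w=\mathbb{E}_{r,\xi}[\mathcal{A}(\mathcal{D}^r;\xi)]$, with $(r,\xi)\sim\mathcal{Q}_n\times\mathrm{Uniform}[0,1]$ (vector-valued expectation), and on a data set of size $n-1$ does the same with $\mathcal{Q}_{n-1}$ in place of $\mathcal{Q}_n$. Mean-square stability: an algorithm (at sample size $n$) has mean-square stability $\beta^2$ with respect to a norm $\|\cdot\|$ if for all $\mathcal{D}=(Z_1,\dots,Z_n)\in\mathcal{Z}^n$, $\frac1n\sum_{i=1}^n\mathbb{E}_\xi[\|\hat w-\hat w^{\setminus i}\|^2]\le\beta^2$, where $\hat w$ is its output on $\mathcal{D}$ and $\hat w^{\setminus i}$ its output, with the same seed $\xi$, on $\mathcal{D}^{\setminus i}=(Z_j)_{j\ne i}\in\mathcal{Z}^{n-1}$ (the expectation is vacuous for deterministic algorithms). *)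

theory Defs
  imports "HOL-Probability.Probability"
begin

text \<open>A data set of size \<open>n\<close> is a list of length \<open>n\<close> over the data space, which is a type.
  Indices of data points run from 1 to \<open>n\<close>, so \<open>Z\<^sub>i\<close> is \<open>D ! (i - 1)\<close>.\<close>

text \<open>The seed lives on the space \<open>[0,1]\<close> itself rather than on the whole real line: algorithms are
  only constrained for seeds in \<open>[0,1]\<close>.\<close>

definition unif01 :: "real measure" where
  "unif01 = restrict_space lborel {0..1}"

definition randomized_algorithm ::
    "'b::topological_space set \<Rightarrow> ('z list \<Rightarrow> real \<Rightarrow> 'b) \<Rightarrow> bool" where
  "randomized_algorithm W A \<longleftrightarrow>
     (\<forall>D. A D \<in> restrict_space borel {0..1} \<rightarrow>\<^sub>M restrict_space borel W)"

definition bag :: "'z list \<Rightarrow> nat list \<Rightarrow> 'z list" where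
  "bag D r = map (\<lambda>i. D ! (i - 1)) r"

definition leave_out :: "'z list \<Rightarrow> nat \<Rightarrow> 'z list" where
  "leave_out D i = take (i - 1) D @ drop i D"

definition seqs :: "nat \<Rightarrow> nat list set" where
  "seqs n = lists {1..n}"

definition symmetric_resampling :: "nat \<Rightarrow> nat list pmf \<Rightarrow> bool" where
  "symmetric_resampling n Q \<longleftrightarrow>
     (\<forall>r \<sigma>. r \<in> seqs n \<and> r \<noteq> [] \<and> \<sigma> permutes {1..n} \<longrightarrow> pmf Q r = pmf Q (map \<sigma> r))"

definition inclusion_prob :: "nat \<Rightarrow> nat list pmf \<Rightarrow> real" where
  "inclusion_prob n Q =
     measure_pmf.expectation Q (\<lambda>r. 1 / real n * (\<Sum>i=1..n. of_bool (i \<in> set r)))"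

definition covariance :: "'a measure \<Rightarrow> ('a \<Rightarrow> real) \<Rightarrow> ('a \<Rightarrow> real) \<Rightarrow> real" where
  "covariance M X Y =
     (\<integral>x. (X x - (\<integral>y. X y \<partial>M)) * (Y x - (\<integral>y. Y y \<partial>M)) \<partial>M)"

definition nonpositive_covariance :: "nat \<Rightarrow> nat list pmf \<Rightarrow> bool" where
  "nonpositive_covariance n Q \<longleftrightarrow>
     (\<forall>i\<in>{1..n}. \<forall>j\<in>{1..n}. i \<noteq> j \<longrightarrow>
        covariance (measure_pmf Q) (\<lambda>r. of_bool (i \<in> set r)) (\<lambda>r. of_bool (j \<in> set r)) \<le> 0)"

text \<open>\<^const>\<open>cond_pmf\<close> is only meaningful if the conditioning event has positive probability. For
  a symmetric \<open>Q\<close> with \<open>inclusion_prob n Q < 1\<close> and \<open>n \<ge> 1\<close> this holds, since the event then has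
  probability \<open>1 - inclusion_prob n Q\<close>.\<close>

definition leave_one_out_compatible :: "nat \<Rightarrow> nat list pmf \<Rightarrow> nat list pmf \<Rightarrow> bool" where
  "leave_one_out_compatible n Q Q' \<longleftrightarrow> Q' = cond_pmf Q {r. n \<notin> set r}"

text \<open>\<open>Q m\<close> is the resampling distribution used for data sets of size \<open>m\<close>. The output of a
  deterministic algorithm ignores the seed.\<close>

definition derandomized_bagging ::
    "('z list \<Rightarrow> real \<Rightarrow> 'b) \<Rightarrow> (nat \<Rightarrow> nat list pmf) \<Rightarrow>
      'z list \<Rightarrow> real \<Rightarrow> 'b::{banach, second_countable_topology}" where
  "derandomized_bagging A Q D = (\<lambda>_.
     (\<integral>(r, \<xi>). A (bag D r) \<xi> \<partial>(measure_pmf (Q (length D)) \<Otimes>\<^sub>M unif01)))"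

text \<open>The argument \<open>b\<close> is the bound usually written \<open>\<beta>\<^sup>2\<close>. The expectation is a nonnegative
  integral, so that a non-integrable squared distance counts as infinite and not as 0.\<close>

definition mean_square_stability ::
    "nat \<Rightarrow> ('z list \<Rightarrow> real \<Rightarrow> 'b::real_normed_vector) \<Rightarrow> real \<Rightarrow> bool" where
  "mean_square_stability n A b \<longleftrightarrow>
     (\<forall>D. length D = n \<longrightarrow>
        ennreal (1 / real n) *
          (\<Sum>i=1..n. \<integral>\<^sup>+\<xi>. ennreal ((norm (A D \<xi> - A (leave_out D i) \<xi>))\<^sup>2) \<partial>unif01)
        \<le> ennreal b)"

definition eta :: "nat \<Rightarrow> real" where
  "eta n = (harm n - 1) / (real n - harm n)"

end

theory Submission
  imports Defs
begin

text \<open>Let \<open>g(r)\<close> be the mean output on the bag \<open>r\<close>, let \<open>X\<^sub>i\<close> indicate \<open>i \<in> r\<close>, and let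
  \<open>\<Delta>\<^sub>i\<close> be the change of the bagged output when point \<open>i\<close> is left out. By symmetry and leave-one-out
  compatibility, \<open>(1 - p) \<Delta>\<^sub>i = E [(X\<^sub>i - p) (g - w\<^sub>0)]\<close> for every fixed \<open>w\<^sub>0\<close>. Pair \<open>\<Delta>\<^sub>i\<close> with a
  norming functional \<open>u\<^sub>i\<close> and put \<open>N\<^sup>2 = \<Sum>\<^sub>i \<parallel>\<Delta>\<^sub>i\<parallel>\<^sup>2\<close>, \<open>a\<^sub>i = \<parallel>\<Delta>\<^sub>i\<parallel> / N\<close>. Then \<open>(1 - p) N\<close> is the
  expectation of the functional \<open>\<Sum>\<^sub>i a\<^sub>i (X\<^sub>i - p) u\<^sub>i\<close> at \<open>g - w\<^sub>0\<close>, which the approximation by the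
  \<open>v\<^sub>k\<close> bounds through the maximum over \<open>k\<close> of the weighted sums \<open>\<Sum>\<^sub>i a\<^sub>i u\<^sub>i(v\<^sub>k) (X\<^sub>i - p)\<close>.

  Given its size, the set of entries of \<open>r\<close> is a uniform subset, so these sums are centred at the
  empirical frequency of the \<open>X\<^sub>i\<close> at a cost controlled by the nonpositive covariances, and the rest
  is a maximal inequality for sampling without replacement. For \<open>1/5 \<le> p \<le> 4/5\<close> it follows from a
  sub-Gaussian bound with variance proxy about \<open>1/4 \<le> 1.6 p (1 - p)\<close>. For extreme \<open>p\<close> a Bernstein bound
  is used, whose linear term is harmless because \<open>\<parallel>\<Delta>\<^sub>i\<parallel> \<le> p R\<close> forces all weights \<open>a\<^sub>i\<close> to be small
  as soon as \<open>N\<close> exceeds the claimed bound.\<close>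

section \<open>Sampling a subset without replacement\<close>

text \<open>Pascal's rule for sums over the subsets of a given size. The inductions over the ground
  set in \<open>maclaurin_inequality\<close> and \<open>subset_sampling_hoeffding\<close> both rest
  on it.\<close>

lemma sum_subsets_of_card_insert:
  fixes F :: "'a set \<Rightarrow> 'b::comm_monoid_add"
  assumes "finite S" "x \<notin> S"
  shows "(\<Sum>B | B \<subseteq> insert x S \<and> card B = Suc m. F B) =
    (\<Sum>B | B \<subseteq> S \<and> card B = Suc m. F B) + (\<Sum>B | B \<subseteq> S \<and> card B = m. F (insert x B))"
proof -
  let ?A = "{B. B \<subseteq> S \<and> card B = Suc m}" and ?C = "{B. B \<subseteq> S \<and> card B = m}"
  have fin: "finite ?A" "finite ?C" using assms(1) by auto
  have inj: "inj_on (insert x) ?C"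
    using assms(2) by (auto intro!: inj_onI)
  have "{B. B \<subseteq> insert x S \<and> card B = Suc m} = ?A \<union> insert x ` ?C"
  proof (intro equalityI subsetI)
    fix B assume B: "B \<in> {B. B \<subseteq> insert x S \<and> card B = Suc m}"
    show "B \<in> ?A \<union> insert x ` ?C"
    proof (cases "x \<in> B")
      case True
      then have "B = insert x (B - {x})" "B - {x} \<in> ?C"
        using B assms(1) by (auto simp: card_Diff_singleton_if)
      then show ?thesis by blast
    qed (use B in auto)
  next
    fix B assume "B \<in> ?A \<union> insert x ` ?C"
    then show "B \<in> {B. B \<subseteq> insert x S \<and> card B = Suc m}"
    proof
      assume "B \<in> insert x ` ?C"
      then obtain B' where B': "B = insert x B'" "B' \<subseteq> S" "card B' = m" by auto
      then have "finite B'" "x \<notin> B'" using assms finite_subset by auto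
      with B' show ?thesis by auto
    qed auto
  qed
  moreover have "?A \<inter> insert x ` ?C = {}" using assms(2) by blast
  ultimately have "(\<Sum>B | B \<subseteq> insert x S \<and> card B = Suc m. F B) = sum F ?A + sum F (insert x ` ?C)"
    using fin by (simp add: sum.union_disjoint)
  then show ?thesis
    unfolding sum.reindex[OF inj] comp_def .
qed

section \<open>Maclaurin's inequality for elementary symmetric sums\<close>

text \<open>The left side is the tangent line at \<open>x\<close> of the map that sends t to
  \<open>t ^ Suc k\<close>, evaluated at \<open>y\<close>; a convex function lies above its
  tangents.\<close>

lemma weighted_am_gm_power:
  fixes x y :: real
  assumes "x \<ge> 0" "y \<ge> 0"
  shows "x ^ k * (real (Suc k) * y - real k * x) \<le> y ^ Suc k"
proof (induction k)
  case (Suc k)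
  have "x ^ Suc k * (real (Suc (Suc k)) * y - real (Suc k) * x)
      = x ^ k * (real (Suc k) * y - real k * x) * y - real (Suc k) * (x ^ k * (x - y)\<^sup>2)"
    by (simp add: algebra_simps power2_eq_square)
  also have "\<dots> \<le> y ^ Suc k * y"
  proof -
    have "0 \<le> real (Suc k) * (x ^ k * (x - y)\<^sup>2)" using assms by simp
    moreover have "x ^ k * (real (Suc k) * y - real k * x) * y \<le> y ^ Suc k * y"
      using Suc.IH assms by (intro mult_right_mono)
    ultimately show ?thesis by linarith
  qed
  finally show ?case by (simp add: mult.commute)
qed simp

text \<open>Compares sampling without replacement to independent draws: for
  \<open>z i = exp (x i)\<close> it bounds the exponential moment of a sum over a uniform
  \<open>m\<close>-subset by that of \<open>m\<close> independent draws. In the induction, the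
  bounds in terms of the mean \<open>a\<close> of the smaller set combine by Pascal's rule into the
  tangent line at \<open>a\<close>, evaluated at the new mean \<open>b\<close>.\<close>

theorem maclaurin_inequality:
  fixes z :: "'a \<Rightarrow> real"
  assumes "finite S" "\<And>i. i \<in> S \<Longrightarrow> z i \<ge> 0"
  shows "(\<Sum>B | B \<subseteq> S \<and> card B = m. \<Prod>i\<in>B. z i)
    \<le> real (card S choose m) * ((\<Sum>i\<in>S. z i) / real (card S)) ^ m"
  using assms
proof (induction S arbitrary: m rule: finite_induct)
  case empty
  have layer: "{B. B \<subseteq> {} \<and> card B = m} = (if m = 0 then {{}} else {})"
    by (auto split: if_splits)
  have empty_sum: "(\<Sum>B | B \<subseteq> {} \<and> card B = m. \<Prod>i\<in>B. z i) = (if m = 0 then 1 else 0)"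
    unfolding layer by simp
  then show ?case by (cases m) (simp_all add: numeral_eq_Suc)
next
  case (insert x S)
  define N where "N = card S"
  define a where "a = (\<Sum>i\<in>S. z i) / real N"
  define b where "b = (\<Sum>i\<in>insert x S. z i) / real (Suc N)"
  have a: "a \<ge> 0"
    unfolding a_def using insert.prems by (intro divide_nonneg_nonneg sum_nonneg) auto
  have b: "b \<ge> 0"
    unfolding b_def using insert.prems by (intro divide_nonneg_nonneg sum_nonneg) auto
  \<comment> \<open>This includes \<open>N = 0\<close>: then \<open>S\<close> is empty, and division
    by zero gives \<open>a = 0\<close>.\<close>
  have Na: "real N * a = (\<Sum>i\<in>S. z i)"
    using insert.hyps by (cases "N = 0") (auto simp: a_def N_def)
  have zx: "z x = real (Suc N) * b - real N * a"
    using insert.hyps unfolding Na b_def by simp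
  show ?case
  proof (cases m)
    case 0
    then have "{B. B \<subseteq> insert x S \<and> card B = m} = {{}}"
      using insert.hyps by (auto dest: finite_subset[of _ "insert x S"])
    then show ?thesis using 0 by simp
  next
    case (Suc k)
    have IH: "(\<Sum>B | B \<subseteq> S \<and> card B = j. \<Prod>i\<in>B. z i) \<le> real (N choose j) * a ^ j" for j
      unfolding N_def a_def using insert by auto
    have ins: "(\<Prod>i\<in>insert x B. z i) = z x * (\<Prod>i\<in>B. z i)" if "B \<subseteq> S" for B
      using that insert.hyps finite_subset[of B S] by (subst prod.insert) auto
    have "(\<Sum>B | B \<subseteq> insert x S \<and> card B = m. \<Prod>i\<in>B. z i)
        = (\<Sum>B | B \<subseteq> S \<and> card B = Suc k. \<Prod>i\<in>B. z i)
          + z x * (\<Sum>B | B \<subseteq> S \<and> card B = k. \<Prod>i\<in>B. z i)"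
      using insert.hyps ins
      by (auto simp: Suc sum_subsets_of_card_insert sum_distrib_left intro!: sum.cong)
    also have "\<dots> \<le> real (N choose Suc k) * a ^ Suc k + z x * (real (N choose k) * a ^ k)"
      using insert.prems by (intro add_mono mult_left_mono IH) auto
    also have "\<dots> = real (Suc N choose Suc k) * (a ^ k * (real (Suc k) * b - real k * a))"
    proof -
      have e1: "real (Suc N) * real (N choose k) = real (Suc k) * real (Suc N choose Suc k)"
        using Suc_times_binomial_eq[of N k] by (metis of_nat_mult mult.commute)
      have e2: "real (Suc N choose Suc k) = real (N choose k) + real (N choose Suc k)" by simp
      have "real (Suc N) * (real (N choose k) * b) = real (Suc k) * real (Suc N choose Suc k) * b"
        using e1 by (simp add: mult.assoc)
      moreover have "real (N choose Suc k) * a - real N * (real (N choose k) * a) = - (real k * (real (Suc N choose Suc k) * a))"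
      proof -
        have "real (N choose Suc k) - real N * real (N choose k) = - real k * real (Suc N choose Suc k)"
          using e1 e2 by (simp add: algebra_simps)
        then show ?thesis by (metis (no_types, opaque_lifting) left_diff_distrib mult.assoc mult_minus_left)
      qed
      ultimately have "real (N choose Suc k) * a + z x * real (N choose k) = real (Suc N choose Suc k) * (real (Suc k) * b - real k * a)"
        unfolding zx by (simp add: algebra_simps)
      then have "a ^ k * (real (N choose Suc k) * a + z x * real (N choose k)) = a ^ k * (real (Suc N choose Suc k) * (real (Suc k) * b - real k * a))"
        by simp
      then show ?thesis by (simp add: algebra_simps)
    qed
    also have "\<dots> \<le> real (Suc N choose Suc k) * b ^ Suc k"
      by (intro mult_left_mono weighted_am_gm_power a b) auto
    finally show ?thesis using insert.hyps by (simp add: Suc b_def N_def)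
  qed
qed

section \<open>Sub-Gaussian exponential moments of uniform subsets\<close>

text \<open>Hoeffding's lemma for the centred variable that is \<open>D * (1 - q)\<close> with
  probability \<open>q\<close> and \<open>- (D * q)\<close> otherwise. The library fact covers
  nonnegative \<open>D\<close>; for negative \<open>D\<close> the two points change places, that is
  \<open>q\<close> becomes \<open>1 - q\<close>.\<close>

lemma hoeffding_two_point:
  fixes D q :: real
  assumes "0 \<le> q" "q \<le> 1"
  shows "q * exp (D * (1 - q)) + (1 - q) * exp (- (D * q)) \<le> exp (D\<^sup>2 / 8)"
proof -
  have *: "r * exp (h * (1 - r)) + (1 - r) * exp (- (h * r)) \<le> exp (h\<^sup>2 / 8)"
    if "h \<ge> 0" "0 \<le> r" "r \<le> 1" for h r :: real
  proof -
    have pos: "1 + r * (exp h - 1) > 0" using that by (intro add_pos_nonneg mult_nonneg_nonneg) auto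
    have "r * exp (h * (1 - r)) + (1 - r) * exp (- (h * r)) = exp (- h * r) * (1 + r * (exp h - 1))"
      by (simp add: algebra_simps exp_diff exp_minus) (simp add: field_simps)
    also have "\<dots> = exp (- h * r + ln (1 + r * (exp h - 1)))"
      by (simp only: exp_add exp_ln[OF pos])
    also have "\<dots> \<le> exp (h\<^sup>2 / 8)"
      using Hoeffdings_lemma_aux[OF that(1,2)] by simp
    finally show ?thesis .
  qed
  show ?thesis
  proof (cases "D \<ge> 0")
    case False
    then show ?thesis using *[of "-D" "1 - q"] assms by (simp add: algebra_simps)
  qed (use *[of D q] assms in auto)
qed

text \<open>The parallel axis identity. It yields the change of the variance when an element is
  removed, and it shows that the sum of squares is smallest when centred at the mean.\<close>

lemma sum_square_shift:
  fixes w :: "'a \<Rightarrow> real"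
  assumes "finite S" "S \<noteq> {}"
  defines "b \<equiv> (\<Sum>i\<in>S. w i) / real (card S)"
  shows "(\<Sum>i\<in>S. (w i - a)\<^sup>2) = (\<Sum>i\<in>S. (w i - b)\<^sup>2) + real (card S) * (a - b)\<^sup>2"
proof -
  have sb: "(\<Sum>i\<in>S. w i) = real (card S) * b" using assms by (simp add: b_def)
  have "(\<Sum>i\<in>S. (w i - a)\<^sup>2) = (\<Sum>i\<in>S. (w i - b)\<^sup>2 + (2 * (b - a) * w i + (a\<^sup>2 - b\<^sup>2)))"
    by (intro sum.cong) (auto simp: power2_eq_square algebra_simps)
  also have "\<dots> = (\<Sum>i\<in>S. (w i - b)\<^sup>2) + (2 * (b - a) * (real (card S) * b) + real (card S) * (a\<^sup>2 - b\<^sup>2))"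
    by (simp add: sum.distrib sum_distrib_left[symmetric] sb)
  finally show ?thesis by (simp add: power2_eq_square algebra_simps)
qed

text \<open>This sequence satisfies the recursion obtained by revealing one sampled element at a time
  (\<open>hoeffding_factor_step\<close>), and the excess over 1 is of the order of \<open>eta\<close>.\<close>

definition hoeffding_factor :: "nat \<Rightarrow> real" where
  "hoeffding_factor n = 1 + 2 * harm n / real n"

lemma harm_ge_1: "n \<ge> 1 \<Longrightarrow> harm n \<ge> (1::real)"
  using harm_mono[of 1 n, where 'a=real] by (simp add: harm_def)

text \<open>The first inequality closes the recursion for the variance proxy in
  \<open>subset_sampling_hoeffding\<close>. The second makes the squared deviation of the revealed
  element enter there with a nonpositive coefficient, so that it can be replaced by its lower bound,
  the average.\<close>

lemma hoeffding_factor_step: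
  assumes "N \<ge> 1"
  shows "hoeffding_factor N * ((real N - 1) / real N) + real (Suc N) / (real N)\<^sup>2 \<le> hoeffding_factor (Suc N)"
    and "hoeffding_factor N \<ge> real (Suc N) / real N"
proof -
  have h: "harm N \<ge> (1::real)" using harm_ge_1[OF assms] .
  have N: "real N \<ge> 1" using assms by simp
  show "hoeffding_factor N \<ge> real (Suc N) / real N"
    using h N by (simp add: hoeffding_factor_def field_simps)
  define x y where "x = real N" and "y = (harm N :: real)"
  have x: "x \<ge> 1" and y: "y \<ge> 1" using h N by (auto simp: x_def y_def)
  have hS: "harm (Suc N) = y + 1 / (x + 1)" by (simp add: harm_Suc x_def y_def inverse_eq_divide add.commute)
  have "(1 + 2 * (y + 1 / (x + 1)) / (x + 1)) - ((1 + 2 * y / x) * ((x - 1) / x) + (x + 1) / x\<^sup>2)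
      = (2 * x\<^sup>2 + 2 * y * (x + 1) - (x + 1)\<^sup>2) / (x\<^sup>2 * (x + 1)\<^sup>2)"
    using x by (simp add: divide_simps power2_eq_square) algebra
  also have "\<dots> \<ge> 0"
  proof (intro divide_nonneg_nonneg)
    have "2 * y * (x + 1) \<ge> 2 * 1 * (x + 1)" using x y by (intro mult_right_mono) auto
    moreover have "2 * x\<^sup>2 + 2 * (x + 1) - (x + 1)\<^sup>2 = x\<^sup>2 + 1" by (simp add: power2_eq_square algebra_simps)
    moreover have "x\<^sup>2 \<ge> 0" by simp
    ultimately show "2 * x\<^sup>2 + 2 * y * (x + 1) - (x + 1)\<^sup>2 \<ge> 0" by linarith
  qed auto
  finally show "hoeffding_factor N * ((real N - 1) / real N) + real (Suc N) / (real N)\<^sup>2 \<le> hoeffding_factor (Suc N)"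
    unfolding hoeffding_factor_def hS by (simp add: x_def y_def add.commute)
qed

text \<open>The induction reveals whether the element with the largest deviation belongs to the subset. Its
  squared deviation is at least the average, which is what makes the recursion for the variance proxy
  close.\<close>

theorem subset_sampling_hoeffding:
  fixes w :: "'a \<Rightarrow> real"
  assumes "finite S"
  defines "b \<equiv> (\<Sum>i\<in>S. w i) / real (card S)"
  shows "(\<Sum>B | B \<subseteq> S \<and> card B = m. exp ((\<Sum>i\<in>B. w i) - real m * b))
    \<le> real (card S choose m) * exp (hoeffding_factor (card S) * (\<Sum>i\<in>S. (w i - b)\<^sup>2) / 8)"
  using assms(1) unfolding b_def
proof (induction "card S" arbitrary: S m)
  case 0
  then have S: "S = {}" by simp
  have layer: "{B. B \<subseteq> {} \<and> card B = m} = (if m = 0 then {{}} else {})"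
    by (auto split: if_splits)
  have empty_sum: "(\<Sum>B | B \<subseteq> {} \<and> card B = m. exp ((\<Sum>i\<in>B. w i) - real m * ((\<Sum>i\<in>{}. w i) / real (card {})))) = (if m = 0 then 1 else 0)"
    unfolding layer by simp
  show ?case unfolding S empty_sum by (cases m) simp_all
next
  case (Suc N S m)
  define a where "a = (\<Sum>i\<in>S. w i) / real (Suc N)"
  define V where "V = (\<Sum>i\<in>S. (w i - a)\<^sup>2)"
  have card: "card S = Suc N" and fin: "finite S" using Suc by auto
  then have ne: "S \<noteq> {}" by auto
  have "Max ((\<lambda>i. (w i - a)\<^sup>2) ` S) \<in> (\<lambda>i. (w i - a)\<^sup>2) ` S"
    using fin ne by (intro Max_in) auto
  then obtain j where j: "j \<in> S" and "Max ((\<lambda>i. (w i - a)\<^sup>2) ` S) = (w j - a)\<^sup>2" by auto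
  then have jmax: "(w i - a)\<^sup>2 \<le> (w j - a)\<^sup>2" if "i \<in> S" for i
    using fin that by (metis (no_types, lifting) Max_ge finite_imageI imageI)
  define T where "T = S - {j}"
  define d where "d = w j - a"
  have T: "S = insert j T" "j \<notin> T" "finite T" "card T = N"
    using j card fin by (auto simp: T_def)
  have d2: "V \<le> real (Suc N) * d\<^sup>2"
    using sum_bounded_above[of S "\<lambda>i. (w i - a)\<^sup>2" "d\<^sup>2"] jmax by (simp add: V_def d_def card)
  have sumS: "(\<Sum>i\<in>T. w i) + w j = real (Suc N) * a"
    using T by (simp add: a_def add.commute)
  have V: "V = d\<^sup>2 + (\<Sum>i\<in>T. (w i - a)\<^sup>2)" using T by (simp add: V_def d_def)
  show ?case
  proof (cases m)
    case 0
    then have "{B. B \<subseteq> S \<and> card B = m} = {{}}"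
      using fin by (auto dest: finite_subset[of _ S])
    moreover have "0 \<le> hoeffding_factor (card S) * V / 8"
      by (simp add: hoeffding_factor_def V_def sum_nonneg harm_nonneg)
    ultimately show ?thesis using 0 by (simp add: V_def a_def card)
  next
    case (Suc k)
    show ?thesis
    proof (cases "N = 0")
      case True
      then have "T = {}" using T by simp
      then have S: "S = {j}" using T by simp
      have layer: "{B. B \<subseteq> {j} \<and> card B = Suc k} = (if k = 0 then {{j}} else {})"
        by (auto simp: subset_singleton_iff)
      show ?thesis unfolding S Suc layer by simp
    next
      case False
      then have N: "real N \<ge> 1" by simp
      define a' where "a' = (\<Sum>i\<in>T. w i) / real N"
      define V' where "V' = (\<Sum>i\<in>T. (w i - a')\<^sup>2)"
      define c where "c = hoeffding_factor N"
      have sumT: "(\<Sum>i\<in>T. w i) = real N * a'" using N by (simp add: a'_def)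
      have a': "a' = a - d / real N"
        using sumS N unfolding sumT d_def by (simp add: field_simps)
      have "(\<Sum>i\<in>T. (w i - a)\<^sup>2) = V' + real N * (a - a')\<^sup>2"
        unfolding V'_def a'_def T(4)[symmetric]
        by (rule sum_square_shift) (use T False in auto)
      then have V': "V' = V - d\<^sup>2 * (real (Suc N) / real N)"
        using N by (simp add: V a' power2_eq_square field_simps)
      \<comment> \<open>\<open>D\<close> is the distance of \<open>w j\<close> from the mean
        \<open>a'\<close> of the other elements, and \<open>q\<close> is the probability that a
        uniform subset of size \<open>Suc k\<close> contains \<open>j\<close>. Revealing this event
        moves the conditional mean of the centred sum to \<open>D * (1 - q)\<close> or to
        \<open>- (D * q)\<close>.\<close>
      define D where "D = d * (real (Suc N) / real N)"
      define q where "q = real (Suc k) / real (Suc N)"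
      have IH: "(\<Sum>B | B \<subseteq> T \<and> card B = i. exp ((\<Sum>i\<in>B. w i) - real i * a')) \<le> real (N choose i) * exp (c * V' / 8)" for i
        using Suc.hyps(1)[of T i] T by (simp add: a'_def V'_def c_def)
      have ins: "(\<Sum>i\<in>insert j B. w i) = w j + (\<Sum>i\<in>B. w i)" if "B \<subseteq> T" for B
        using that T finite_subset[of B T] by (subst sum.insert) auto
      have Dq: "D * q = real (Suc k) * (d / real N)"
      proof -
        have "real (Suc N) \<noteq> 0" by simp
        then show ?thesis unfolding D_def q_def by (simp del: of_nat_Suc)
      qed
      have D: "D = d + d / real N" using N by (simp add: D_def field_simps)
      have out: "(\<Sum>i\<in>B. w i) - real m * a = ((\<Sum>i\<in>B. w i) - real (Suc k) * a') - D * q" for B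
        unfolding Dq a' by (simp add: Suc algebra_simps)
      have inn: "(\<Sum>i\<in>insert j B. w i) - real m * a = ((\<Sum>i\<in>B. w i) - real k * a') + D * (1 - q)" if "B \<subseteq> T" for B
        unfolding ins[OF that] right_diff_distrib Dq mult_1_right unfolding D a' by (simp add: Suc d_def algebra_simps add_divide_distrib diff_divide_distrib)
      have "(\<Sum>B | B \<subseteq> S \<and> card B = m. exp ((\<Sum>i\<in>B. w i) - real m * a))
        = exp (- (D * q)) * (\<Sum>B | B \<subseteq> T \<and> card B = Suc k. exp ((\<Sum>i\<in>B. w i) - real (Suc k) * a'))
        + exp (D * (1 - q)) * (\<Sum>B | B \<subseteq> T \<and> card B = k. exp ((\<Sum>i\<in>B. w i) - real k * a'))"
      proof -
        have "(\<Sum>B | B \<subseteq> S \<and> card B = m. exp ((\<Sum>i\<in>B. w i) - real m * a))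
          = (\<Sum>B | B \<subseteq> T \<and> card B = Suc k. exp ((\<Sum>i\<in>B. w i) - real m * a))
          + (\<Sum>B | B \<subseteq> T \<and> card B = k. exp ((\<Sum>i\<in>insert j B. w i) - real m * a))"
          unfolding T(1) Suc using T by (intro sum_subsets_of_card_insert) auto
        also have "(\<Sum>B | B \<subseteq> T \<and> card B = Suc k. exp ((\<Sum>i\<in>B. w i) - real m * a))
          = (\<Sum>B | B \<subseteq> T \<and> card B = Suc k. exp (- (D * q)) * exp ((\<Sum>i\<in>B. w i) - real (Suc k) * a'))"
          unfolding out exp_add[symmetric] by (intro sum.cong refl arg_cong[of _ _ exp]) linarith
        also have "(\<Sum>B | B \<subseteq> T \<and> card B = k. exp ((\<Sum>i\<in>insert j B. w i) - real m * a))
          = (\<Sum>B | B \<subseteq> T \<and> card B = k. exp (D * (1 - q)) * exp ((\<Sum>i\<in>B. w i) - real k * a'))"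
          by (intro sum.cong refl, subst inn) (auto simp: exp_add[symmetric])
        finally show ?thesis by (simp add: sum_distrib_left)
      qed
      also have "\<dots> \<le> exp (- (D * q)) * (real (N choose Suc k) * exp (c * V' / 8))
        + exp (D * (1 - q)) * (real (N choose k) * exp (c * V' / 8))"
        by (intro add_mono mult_left_mono IH) auto
      also have "\<dots> = exp (c * V' / 8) * (real (N choose k) * exp (D * (1 - q)) + real (N choose Suc k) * exp (- (D * q)))"
        by (simp add: algebra_simps)
      also have "\<dots> = real (Suc N choose Suc k) * exp (c * V' / 8) * (q * exp (D * (1 - q)) + (1 - q) * exp (- (D * q)))"
      proof -
        have e1: "real (N choose k) = real (Suc N choose Suc k) * q"
        proof -
          have "real (Suc N) * real (N choose k) = real (Suc k) * real (Suc N choose Suc k)"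
            using Suc_times_binomial_eq[of N k] by (metis of_nat_mult mult.commute)
          then show ?thesis by (simp add: q_def field_simps)
        qed
        have "real (N choose Suc k) = real (Suc N choose Suc k) - real (N choose k)" by simp
        then have e2: "real (N choose Suc k) = real (Suc N choose Suc k) * (1 - q)"
          unfolding e1 by (simp add: algebra_simps)
        show ?thesis unfolding e1 e2 by (simp add: algebra_simps)
      qed
      also have "\<dots> \<le> real (Suc N choose Suc k) * exp (hoeffding_factor (Suc N) * V / 8)"
      \<comment> \<open>Only here is \<open>q\<close> a probability; otherwise the binomial
        coefficient vanishes.\<close>
      proof (cases "Suc k \<le> Suc N")
        case True
        have "q * exp (D * (1 - q)) + (1 - q) * exp (- (D * q)) \<le> exp (D\<^sup>2 / 8)"
          using True by (intro hoeffding_two_point) (auto simp: q_def)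
        moreover have "c * V' + D\<^sup>2 \<le> hoeffding_factor (Suc N) * V"
        proof -
          define r where "r = real (Suc N) / real N"
          have r: "r \<ge> 0" "c \<ge> r" using hoeffding_factor_step(2)[of N] False by (auto simp: r_def c_def)
          have "c * V' + D\<^sup>2 = c * V - r * (c - r) * d\<^sup>2"
            unfolding V' D_def r_def[symmetric] by (simp add: power2_eq_square algebra_simps)
          also have "\<dots> \<le> c * V - r * (c - r) * (V / real (Suc N))"
            using d2 r by (intro diff_left_mono mult_left_mono mult_nonneg_nonneg) (simp_all add: field_simps)
          also have "\<dots> = V * (c * ((real N - 1) / real N) + real (Suc N) / (real N)\<^sup>2)"
            using N by (simp add: r_def divide_simps power2_eq_square) (simp add: algebra_simps)
          also have "\<dots> \<le> V * hoeffding_factor (Suc N)"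
            using hoeffding_factor_step(1)[of N] False
            by (intro mult_left_mono) (auto simp: c_def V_def sum_nonneg)
          finally show ?thesis by (simp add: mult.commute)
        qed
        ultimately have "exp (c * V' / 8) * (q * exp (D * (1 - q)) + (1 - q) * exp (- (D * q))) \<le> exp (c * V' / 8) * exp (D\<^sup>2 / 8)"
          by (intro mult_left_mono) auto
        also have "\<dots> = exp ((c * V' + D\<^sup>2) / 8)" by (simp add: exp_add[symmetric] add_divide_distrib)
        also have "\<dots> \<le> exp (hoeffding_factor (Suc N) * V / 8)"
          using \<open>c * V' + D\<^sup>2 \<le> hoeffding_factor (Suc N) * V\<close> by simp
        finally show ?thesis unfolding mult.assoc by (intro mult_left_mono) auto
      qed (simp add: binomial_eq_0)
      finally show ?thesis unfolding card a_def[symmetric] V_def[symmetric] Suc .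
    qed
  qed
qed

section \<open>Maximal inequality from exponential moments\<close>

text \<open>The bound on the expected maximum by exponential moments, with both signs counted, hence
  the factor 2. Jensen's inequality for \<open>ln\<close> is replaced by its tangent at
  \<open>c\<close>, the bound on the sum of all mean exponentials; this is a pointwise estimate that
  can be summed over \<open>A\<close>.\<close>

lemma sum_Max_abs_le:
  fixes Y :: "'k \<Rightarrow> 'o \<Rightarrow> real"
  assumes fin: "finite I" "I \<noteq> {}" and l: "l > 0"
    and pos: "\<And>k. k \<in> I \<Longrightarrow> (\<Sum>x\<in>A. exp (l * Y k x)) \<le> real (card A) * exp v"
    and neg: "\<And>k. k \<in> I \<Longrightarrow> (\<Sum>x\<in>A. exp (l * - Y k x)) \<le> real (card A) * exp v"
  shows "(\<Sum>x\<in>A. MAX k\<in>I. \<bar>Y k x\<bar>) \<le> real (card A) * ((ln (2 * real (card I)) + v) / l)"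
proof -
  define c where "c = 2 * real (card I) * exp v"
  have cI: "real (card I) > 0" using fin by (simp add: card_gt_0_iff)
  have c: "c > 0" using cI by (simp add: c_def)
  have ln_c: "ln c = ln (2 * real (card I)) + v" using cI by (simp add: c_def ln_mult)
  have pt: "l * (MAX k\<in>I. \<bar>Y k x\<bar>) \<le> (\<Sum>k\<in>I. exp (l * Y k x) + exp (l * - Y k x)) / c - 1 + ln c" for x
  proof -
    have "(MAX k\<in>I. \<bar>Y k x\<bar>) \<in> (\<lambda>k. \<bar>Y k x\<bar>) ` I" using fin by (intro Max_in) auto
    then obtain k where k: "k \<in> I" "(MAX k\<in>I. \<bar>Y k x\<bar>) = \<bar>Y k x\<bar>" by auto
    define y where "y = l * \<bar>Y k x\<bar>"
    have "y = ln (exp y / c) + ln c" using c by (simp add: ln_div)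
    also have "\<dots> \<le> exp y / c - 1 + ln c" using ln_le_minus_one[of "exp y / c"] c by simp
    also have "exp y \<le> exp (l * Y k x) + exp (l * - Y k x)"
      unfolding y_def by (cases "Y k x \<ge> 0") auto
    also have "\<dots> \<le> (\<Sum>k\<in>I. exp (l * Y k x) + exp (l * - Y k x))"
      using k fin by (intro member_le_sum) (auto intro!: add_nonneg_nonneg)
    finally show ?thesis unfolding k(2) y_def using c by (simp add: divide_right_mono)
  qed
  have "l * (\<Sum>x\<in>A. MAX k\<in>I. \<bar>Y k x\<bar>) = (\<Sum>x\<in>A. l * (MAX k\<in>I. \<bar>Y k x\<bar>))"
    by (simp add: sum_distrib_left)
  also have "\<dots> \<le> (\<Sum>x\<in>A. (\<Sum>k\<in>I. exp (l * Y k x) + exp (l * - Y k x)) / c - 1 + ln c)"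
    by (intro sum_mono pt)
  also have "\<dots> = (\<Sum>k\<in>I. (\<Sum>x\<in>A. exp (l * Y k x)) + (\<Sum>x\<in>A. exp (l * - Y k x))) / c + real (card A) * (ln c - 1)"
    by (simp add: sum.distrib sum_subtractf sum_divide_distrib[symmetric] algebra_simps sum.swap[of _ I A])
  also have "\<dots> \<le> (\<Sum>k\<in>I. real (card A) * exp v + real (card A) * exp v) / c + real (card A) * (ln c - 1)"
    using c pos neg by (intro add_right_mono divide_right_mono sum_mono add_mono) auto
  also have "(\<Sum>k\<in>I. real (card A) * exp v + real (card A) * exp v) / c = real (card A)"
    using cI by (simp add: c_def)
  finally have "l * (\<Sum>x\<in>A. MAX k\<in>I. \<bar>Y k x\<bar>) \<le> real (card A) * ln c" by (simp add: algebra_simps)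
  then show ?thesis using l by (simp add: ln_c field_simps)
qed

text \<open>The centring uses the actual size of \<open>B\<close>, so the mean over all subsets of
  one size is 0. The fluctuation of that size is treated apart, in
  \<open>expectation_abs_centered_count_le\<close>.\<close>

definition sampling_deviation :: "'a set \<Rightarrow> ('a \<Rightarrow> real) \<Rightarrow> 'a set \<Rightarrow> real" where
  "sampling_deviation S w B = (\<Sum>i\<in>B. w i) - real (card B) * ((\<Sum>i\<in>S. w i) / real (card S))"

lemma sampling_deviation_scale:
  "sampling_deviation S (\<lambda>i. c * w i) B = c * sampling_deviation S w B"
  by (simp add: sampling_deviation_def sum_distrib_left[symmetric] right_diff_distrib)

theorem expected_max_sampling_deviation_hoeffding:
  fixes w :: "'k \<Rightarrow> 'a \<Rightarrow> real"
  assumes S: "finite S" "S \<noteq> {}" and I: "finite I" "I \<noteq> {}"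
    and w: "\<And>k. k \<in> I \<Longrightarrow> (\<Sum>i\<in>S. (w k i)\<^sup>2) \<le> 1"
  shows "(\<Sum>B | B \<subseteq> S \<and> card B = m. MAX k\<in>I. \<bar>sampling_deviation S (w k) B\<bar>)
    \<le> real (card S choose m) * sqrt (ln (2 * real (card I)) * hoeffding_factor (card S) / 2)"
proof -
  define L where "L = ln (2 * real (card I))"
  define c where "c = hoeffding_factor (card S)"
  have "real (card I) \<ge> 1" using I by (simp add: Suc_leI card_gt_0_iff)
  then have L: "L > 0" by (simp add: L_def)
  have c: "c > 0" by (simp add: c_def hoeffding_factor_def harm_nonneg add_pos_nonneg)
  \<comment> \<open>This choice gives \<open>c * l\<^sup>2 / 8 = L\<close>, so that the entropy term
    and the variance term of the maximal inequality are equal.\<close>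
  define l where "l = sqrt (8 * L / c)"
  have l: "l > 0" "l\<^sup>2 = 8 * L / c" using L c by (auto simp: l_def)
  have *: "(\<Sum>B | B \<subseteq> S \<and> card B = m. exp (l * (s * sampling_deviation S (w k) B)))
      \<le> real (card {B. B \<subseteq> S \<and> card B = m}) * exp L" if k: "k \<in> I" and s: "s\<^sup>2 = 1" for k s
  proof -
    define x where "x i = l * s * w k i" for i
    define b where "b = (\<Sum>i\<in>S. x i) / real (card S)"
    have "(\<Sum>B | B \<subseteq> S \<and> card B = m. exp (l * (s * sampling_deviation S (w k) B)))
      = (\<Sum>B | B \<subseteq> S \<and> card B = m. exp ((\<Sum>i\<in>B. x i) - real m * b))"
      by (intro sum.cong refl)
        (auto simp: x_def b_def sampling_deviation_def sum_distrib_left[symmetric] algebra_simps)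
    also have "\<dots> \<le> real (card S choose m) * exp (c * (\<Sum>i\<in>S. (x i - b)\<^sup>2) / 8)"
      unfolding b_def c_def by (rule subset_sampling_hoeffding) fact
    also have "(\<Sum>i\<in>S. (x i - b)\<^sup>2) \<le> (\<Sum>i\<in>S. (x i - 0)\<^sup>2)"
      unfolding b_def by (subst (2) sum_square_shift) (use S in auto)
    also have "\<dots> = l\<^sup>2 * (\<Sum>i\<in>S. (w k i)\<^sup>2)"
      using s by (simp add: x_def power_mult_distrib sum_distrib_left)
    also have "\<dots> \<le> l\<^sup>2 * 1" using w[OF k] by (intro mult_left_mono) auto
    also have "c * (l\<^sup>2 * 1) / 8 = L" using c l by simp
    finally show ?thesis
      using S c by (simp add: n_subsets divide_right_mono mult_left_mono)
  qed
  have "(\<Sum>B | B \<subseteq> S \<and> card B = m. MAX k\<in>I. \<bar>sampling_deviation S (w k) B\<bar>)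
    \<le> real (card {B. B \<subseteq> S \<and> card B = m}) * ((L + L) / l)"
    unfolding L_def by (rule sum_Max_abs_le) (use I l(1) *[of _ 1] *[of _ "-1"] in \<open>auto simp: L_def\<close>)
  also have "(L + L) / l = sqrt (L * c / 2)"
  proof (rule real_sqrt_unique[symmetric])
    show "((L + L) / l)\<^sup>2 = L * c / 2"
      using l L c by (simp add: power_divide power2_eq_square field_simps)
  qed (use L l in auto)
  finally show ?thesis by (simp add: n_subsets S c_def L_def)
qed

section \<open>Bernstein-type bounds for bounded weights\<close>

text \<open>The constants make the Bernstein bound close at \<open>p = 1/5\<close>: with exponents of size at most
  \<open>\<theta> = 3/5\<close>, the requirement there is \<open>1 + 4 (e\<^sup>\<theta> - 1 - \<theta>) \<le> 3.2 \<theta>\<close>, that is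
  \<open>e\<^sup>\<theta> - 1 - \<theta> \<le> 23/100 = 23/36 \<theta>\<^sup>2\<close>.\<close>

lemma exp_le_quadratic:
  fixes x :: real
  assumes "\<bar>x\<bar> \<le> 3 / 5"
  shows "exp x \<le> 1 + x + 23 / 36 * x\<^sup>2"
proof -
  obtain t where t: "\<bar>t\<bar> \<le> \<bar>x\<bar>" "exp x = (\<Sum>m<4. x ^ m / fact m) + exp t / fact 4 * x ^ 4"
    using Maclaurin_exp_le[of x 4] by auto
  have "exp t \<le> exp (3 / 5 :: real)" using t(1) assms by simp
  also have "\<dots> \<le> 2" using exp_bound[of "3 / 5"] by (simp add: power2_eq_square)
  finally have et: "exp t \<le> 2" .
  have x2: "x\<^sup>2 \<le> 9 / 25" using assms power_mono[of "\<bar>x\<bar>" "3/5" 2] by (simp add: power2_eq_square)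
  have "exp t / fact 4 * x ^ 4 = (exp t * x\<^sup>2) * x\<^sup>2 / 24"
    by (simp add: power2_eq_square eval_nat_numeral fact_numeral)
  also have "\<dots> \<le> (2 * (9 / 25)) * x\<^sup>2 / 24"
    using et x2 by (intro divide_right_mono mult_right_mono mult_mono) auto
  finally have r: "exp t / fact 4 * x ^ 4 \<le> 3 / 100 * x\<^sup>2" by simp
  have "x ^ 3 = x * x\<^sup>2" by (simp add: power2_eq_square power3_eq_cube)
  also have "\<dots> \<le> 3 / 5 * x\<^sup>2" using assms by (intro mult_right_mono) auto
  finally have c: "x ^ 3 \<le> 3 / 5 * x\<^sup>2" .
  have "(\<Sum>m<4. x ^ m / fact m) = 1 + x + x\<^sup>2 / 2 + x ^ 3 / 6"
    by (simp add: numeral_eq_Suc lessThan_Suc)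
  then have "exp x \<le> 1 + x + x\<^sup>2 / 2 + x ^ 3 / 6 + 3 / 100 * x\<^sup>2"
    using t(2) r by linarith
  \<comment> \<open>The cubic term adds 1/10 and the remainder 3/100 to the coefficient 1/2, and
    63/100 is below 23/36.\<close>
  then show ?thesis using c zero_le_power2[of x] by linarith
qed

text \<open>Maclaurin's inequality reduces the exponential moment to a power of the mean of the
  \<open>exp (x i)\<close>. The quadratic bound on \<open>exp\<close> controls this mean; its linear
  part cancels against the centring, and only the sum of squares times the sampling fraction
  remains.\<close>

lemma maclaurin_inequality_exp:
  fixes x :: "'a \<Rightarrow> real"
  assumes S: "finite S" "S \<noteq> {}" and m: "m \<le> card S" and x: "\<And>i. i \<in> S \<Longrightarrow> \<bar>x i\<bar> \<le> 3 / 5"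
  shows "(\<Sum>B | B \<subseteq> S \<and> card B = m. exp (sampling_deviation S x B))
    \<le> real (card S choose m) * exp (23 / 36 * (real m / real (card S)) * (\<Sum>i\<in>S. (x i)\<^sup>2))"
proof -
  define N where "N = real (card S)"
  have N: "N > 0" using S by (simp add: N_def card_gt_0_iff)
  define b where "b = (\<Sum>i\<in>S. x i) / N"
  define y where "y = 23 / 36 * (\<Sum>i\<in>S. (x i)\<^sup>2) / N"
  have pow: "((\<Sum>i\<in>S. exp (x i)) / N) ^ m \<le> exp (b + y) ^ m"
  proof (intro power_mono)
    have "(\<Sum>i\<in>S. exp (x i)) \<le> (\<Sum>i\<in>S. 1 + x i + 23 / 36 * (x i)\<^sup>2)"
      using x by (intro sum_mono exp_le_quadratic) auto
    also have "\<dots> = N + (\<Sum>i\<in>S. x i) + 23 / 36 * (\<Sum>i\<in>S. (x i)\<^sup>2)"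
      by (simp only: sum.distrib sum_distrib_left[symmetric] N_def) simp
    also have "\<dots> = N * (1 + (b + y))"
      using N by (simp add: b_def y_def distrib_left)
    also have "\<dots> \<le> N * exp (b + y)" using N by (intro mult_left_mono exp_ge_add_one_self) auto
    finally show "(\<Sum>i\<in>S. exp (x i)) / N \<le> exp (b + y)" using N by (simp add: field_simps)
  qed (use N in \<open>auto intro!: divide_nonneg_nonneg sum_nonneg\<close>)
  have "(\<Sum>B | B \<subseteq> S \<and> card B = m. exp (sampling_deviation S x B))
    = exp (- (real m * b)) * (\<Sum>B | B \<subseteq> S \<and> card B = m. \<Prod>i\<in>B. exp (x i))"
    unfolding sum_distrib_left
  proof (intro sum.cong refl)
    fix B assume "B \<in> {B. B \<subseteq> S \<and> card B = m}"
    then have "finite B" "card B = m" using S finite_subset by auto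
    then show "exp (sampling_deviation S x B) = exp (- (real m * b)) * (\<Prod>i\<in>B. exp (x i))"
      by (simp add: sampling_deviation_def exp_sum[symmetric] exp_add[symmetric] b_def N_def)
  qed
  also have "\<dots> \<le> exp (- (real m * b)) * (real (card S choose m) * ((\<Sum>i\<in>S. exp (x i)) / N) ^ m)"
    unfolding N_def using S by (intro mult_left_mono maclaurin_inequality) auto
  also have "\<dots> \<le> exp (- (real m * b)) * (real (card S choose m) * exp (b + y) ^ m)"
    by (intro mult_left_mono pow) auto
  also have "exp (- (real m * b)) * (real (card S choose m) * exp (b + y) ^ m)
    = real (card S choose m) * exp (real m * y)"
    by (simp add: exp_of_nat_mult[symmetric] exp_add[symmetric] algebra_simps)
  finally show ?thesis by (simp add: y_def N_def mult_ac)
qed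

theorem expected_max_sampling_deviation_bernstein:
  fixes w :: "'k \<Rightarrow> 'a \<Rightarrow> real"
  assumes S: "finite S" "S \<noteq> {}" and m: "m \<le> card S" and I: "finite I" "I \<noteq> {}" and b: "b > 0"
    and w: "\<And>k. k \<in> I \<Longrightarrow> (\<Sum>i\<in>S. (w k i)\<^sup>2) \<le> 1"
    and wb: "\<And>k i. k \<in> I \<Longrightarrow> i \<in> S \<Longrightarrow> \<bar>w k i\<bar> \<le> b"
  shows "(\<Sum>B | B \<subseteq> S \<and> card B = m. MAX k\<in>I. \<bar>sampling_deviation S (w k) B\<bar>)
    \<le> real (card S choose m) *
        (5 * b / 3 * (ln (2 * real (card I)) + 23 / 100 / b\<^sup>2 * (real m / real (card S))))"
proof -
  \<comment> \<open>The largest multiplier that keeps all exponents within 3/5, given weights of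
    size at most \<open>b\<close>; with it, \<open>23 / 36 * l\<^sup>2\<close> is
    \<open>23 / 100 / b\<^sup>2\<close>.\<close>
  define l where "l = 3 / (5 * b)"
  define q where "q = real m / real (card S)"
  have l: "l > 0" using b by (simp add: l_def)
  have *: "(\<Sum>B | B \<subseteq> S \<and> card B = m. exp (l * (s * sampling_deviation S (w k) B)))
      \<le> real (card {B. B \<subseteq> S \<and> card B = m}) * exp (23 / 100 / b\<^sup>2 * q)"
    if k: "k \<in> I" and s: "\<bar>s\<bar> = 1" for k s
  proof -
    have s2: "s\<^sup>2 = 1" using s by (metis one_power2 power2_abs)
    have "(\<Sum>B | B \<subseteq> S \<and> card B = m. exp (l * (s * sampling_deviation S (w k) B)))
      = (\<Sum>B | B \<subseteq> S \<and> card B = m. exp (sampling_deviation S (\<lambda>i. l * s * w k i) B))"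
      by (simp add: sampling_deviation_scale mult.assoc)
    also have "\<dots> \<le> real (card S choose m) * exp (23 / 36 * q * (\<Sum>i\<in>S. (l * s * w k i)\<^sup>2))"
      unfolding q_def
    proof (rule maclaurin_inequality_exp[OF S m])
      fix i assume "i \<in> S"
      then show "\<bar>l * s * w k i\<bar> \<le> 3 / 5"
        using wb[OF k] b s by (simp add: l_def abs_mult field_simps)
    qed
    also have "(\<Sum>i\<in>S. (l * s * w k i)\<^sup>2) = l\<^sup>2 * (\<Sum>i\<in>S. (w k i)\<^sup>2)"
      using s2 by (simp add: power_mult_distrib sum_distrib_left)
    also have "23 / 36 * q * (l\<^sup>2 * (\<Sum>i\<in>S. (w k i)\<^sup>2)) \<le> 23 / 36 * q * (l\<^sup>2 * 1)"
      using w[OF k] by (intro mult_left_mono) (auto simp: q_def)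
    also have "\<dots> = 23 / 100 / b\<^sup>2 * q"
      using b by (simp add: l_def power2_eq_square field_simps)
    finally show ?thesis using S by (simp add: n_subsets mult_left_mono)
  qed
  have "(\<Sum>B | B \<subseteq> S \<and> card B = m. MAX k\<in>I. \<bar>sampling_deviation S (w k) B\<bar>)
    \<le> real (card {B. B \<subseteq> S \<and> card B = m}) * ((ln (2 * real (card I)) + 23 / 100 / b\<^sup>2 * q) / l)"
    by (rule sum_Max_abs_le) (use I l *[of _ 1] *[of _ "-1"] in auto)
  then show ?thesis using b by (simp add: n_subsets S l_def q_def field_simps)
qed

lemma sampling_deviation_Compl:
  assumes "finite S" "S \<noteq> {}" "B \<subseteq> S"
  shows "sampling_deviation S w (S - B) = - sampling_deviation S w B"
proof -
  have "finite B" using assms finite_subset by auto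
  moreover have "card B \<le> card S" using assms by (intro card_mono)
  moreover have "real (card S) > 0" using assms by (simp add: card_gt_0_iff)
  ultimately show ?thesis
    using assms by (simp add: sampling_deviation_def sum_diff card_Diff_subset of_nat_diff left_diff_distrib diff_divide_distrib)
qed

text \<open>The complement of a uniform subset is again uniform and its deviation differs only in
  sign. Passing to it replaces the sampling fraction by one minus it, which gives the right variance
  when most elements are sampled.\<close>

corollary expected_max_sampling_deviation_bernstein_Compl:
  fixes w :: "'k \<Rightarrow> 'a \<Rightarrow> real"
  assumes S: "finite S" "S \<noteq> {}" and m: "m \<le> card S" and I: "finite I" "I \<noteq> {}" and b: "b > 0"
    and w: "\<And>k. k \<in> I \<Longrightarrow> (\<Sum>i\<in>S. (w k i)\<^sup>2) \<le> 1"
    and wb: "\<And>k i. k \<in> I \<Longrightarrow> i \<in> S \<Longrightarrow> \<bar>w k i\<bar> \<le> b"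
  shows "(\<Sum>B | B \<subseteq> S \<and> card B = m. MAX k\<in>I. \<bar>sampling_deviation S (w k) B\<bar>)
    \<le> real (card S choose m) *
        (5 * b / 3 * (ln (2 * real (card I)) + 23 / 100 / b\<^sup>2 * (1 - real m / real (card S))))"
proof -
  define n where "n = card S"
  have n: "real n > 0" using S by (simp add: n_def card_gt_0_iff)
  have "(\<Sum>B | B \<subseteq> S \<and> card B = m. MAX k\<in>I. \<bar>sampling_deviation S (w k) B\<bar>)
    = (\<Sum>B | B \<subseteq> S \<and> card B = n - m. MAX k\<in>I. \<bar>sampling_deviation S (w k) B\<bar>)"
  proof (rule sum.reindex_bij_witness[of _ "\<lambda>B. S - B" "\<lambda>B. S - B"])
    fix B assume B: "B \<in> {B. B \<subseteq> S \<and> card B = m}"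
    then have "finite B" using S finite_subset by auto
    then show "S - (S - B) = B" "S - B \<in> {B. B \<subseteq> S \<and> card B = n - m}"
      using B by (auto simp: n_def card_Diff_subset)
    show "(MAX k\<in>I. \<bar>sampling_deviation S (w k) (S - B)\<bar>) = (MAX k\<in>I. \<bar>sampling_deviation S (w k) B\<bar>)"
      using B S by (simp add: sampling_deviation_Compl)
  next
    fix B assume B: "B \<in> {B. B \<subseteq> S \<and> card B = n - m}"
    then have "finite B" using S finite_subset by auto
    then show "S - (S - B) = B" "S - B \<in> {B. B \<subseteq> S \<and> card B = m}"
      using B m by (auto simp: n_def card_Diff_subset)
  qed
  also have "\<dots> \<le> real (card S choose (n - m)) *
      (5 * b / 3 * (ln (2 * real (card I)) + 23 / 100 / b\<^sup>2 * (real (n - m) / real (card S))))"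
    using assms by (intro expected_max_sampling_deviation_bernstein) (auto simp: n_def)
  also have "real (n - m) / real (card S) = 1 - real m / real (card S)"
    using m n by (simp add: n_def of_nat_diff diff_divide_distrib)
  also have "card S choose (n - m) = card S choose m"
    using m by (simp add: n_def binomial_symmetric[of m])
  finally show ?thesis .
qed

section \<open>Norming functionals\<close>

definition sublinear :: "('b::real_vector \<Rightarrow> real) \<Rightarrow> bool" where
  "sublinear p \<longleftrightarrow> (\<forall>x y. p (x + y) \<le> p x + p y) \<and> (\<forall>t\<ge>0. \<forall>x. p (t *\<^sub>R x) = t * p x)"

text \<open>Lowers a sublinear \<open>p\<close> in the direction \<open>- y\<close>: the term
  \<open>t = 0\<close> keeps it below \<open>p\<close>, and the term \<open>t = 1\<close> brings its
  value at \<open>- y\<close> down to at most \<open>- p y\<close>.\<close>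

definition sublinear_lower :: "('b::real_vector \<Rightarrow> real) \<Rightarrow> 'b \<Rightarrow> 'b \<Rightarrow> real" where
  "sublinear_lower p y x = (INF t\<in>{0..}. p (x + t *\<^sub>R y) - t * p y)"

lemma sublinearD:
  assumes "sublinear p"
  shows "p (x + y) \<le> p x + p y" "t \<ge> 0 \<Longrightarrow> p (t *\<^sub>R x) = t * p x" "p 0 = 0" "- p (- x) \<le> p x"
proof -
  show *: "p (x + y) \<le> p x + p y" for x y using assms by (simp add: sublinear_def)
  show **: "t \<ge> 0 \<Longrightarrow> p (t *\<^sub>R x) = t * p x" for t x using assms by (simp add: sublinear_def)
  show "p 0 = 0" using **[of 0 0] by simp
  then show "- p (- x) \<le> p x" using *[of x "-x"] by simp
qed

lemma sublinear_lower_bdd_below: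
  assumes "sublinear p"
  shows "bdd_below ((\<lambda>t. p (x + t *\<^sub>R y) - t * p y) ` {0..})"
proof (rule bdd_belowI2)
  fix t :: real assume "t \<in> {0..}"
  then have "t * p y = p (t *\<^sub>R y)" using sublinearD(2)[OF assms] by simp
  also have "\<dots> \<le> p (x + t *\<^sub>R y) + p (- x)"
    using sublinearD(1)[OF assms, of "x + t *\<^sub>R y" "- x"] by simp
  finally show "- p (- x) \<le> p (x + t *\<^sub>R y) - t * p y" by simp
qed

lemma sublinear_lower_le:
  assumes "sublinear p" "t \<ge> 0"
  shows "sublinear_lower p y x \<le> p (x + t *\<^sub>R y) - t * p y"
  unfolding sublinear_lower_def
  using assms by (intro cINF_lower sublinear_lower_bdd_below) auto

lemma sublinear_lower_greatest:
  assumes "\<And>t. t \<ge> 0 \<Longrightarrow> c \<le> p (x + t *\<^sub>R y) - t * p y"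
  shows "c \<le> sublinear_lower p y x"
  unfolding sublinear_lower_def using assms by (intro cINF_greatest) auto

lemma sublinear_sublinear_lower:
  assumes p: "sublinear p"
  shows "sublinear (sublinear_lower p y)"
proof -
  let ?q = "sublinear_lower p y"
  have add: "?q (a + b) \<le> ?q a + ?q b" for a b
  proof -
    have "?q (a + b) - (p (b + t *\<^sub>R y) - t * p y) \<le> p (a + s *\<^sub>R y) - s * p y" if "s \<ge> 0" "t \<ge> 0" for s t
    proof -
      have "?q (a + b) \<le> p ((a + b) + (s + t) *\<^sub>R y) - (s + t) * p y"
        using that by (intro sublinear_lower_le p) auto
      also have "(a + b) + (s + t) *\<^sub>R y = (a + s *\<^sub>R y) + (b + t *\<^sub>R y)" by (simp add: algebra_simps)
      also have "p \<dots> \<le> p (a + s *\<^sub>R y) + p (b + t *\<^sub>R y)" by (rule sublinearD(1)[OF p])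
      finally show ?thesis by (simp add: algebra_simps)
    qed
    then have "?q (a + b) - (p (b + t *\<^sub>R y) - t * p y) \<le> ?q a" if "t \<ge> 0" for t
      using that by (intro sublinear_lower_greatest) auto
    then have "?q (a + b) - ?q a \<le> p (b + t *\<^sub>R y) - t * p y" if "t \<ge> 0" for t
      using that by (simp add: algebra_simps)
    then have "?q (a + b) - ?q a \<le> ?q b" by (rule sublinear_lower_greatest)
    then show ?thesis by simp
  qed
  have le: "?q (c *\<^sub>R x) \<le> c * ?q x" if c: "c > 0" for c x
  proof -
    have "?q (c *\<^sub>R x) / c \<le> p (x + t *\<^sub>R y) - t * p y" if "t \<ge> 0" for t
    proof -
      have "?q (c *\<^sub>R x) \<le> p (c *\<^sub>R x + (c * t) *\<^sub>R y) - (c * t) * p y"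
        using that c by (intro sublinear_lower_le p) auto
      also have "c *\<^sub>R x + (c * t) *\<^sub>R y = c *\<^sub>R (x + t *\<^sub>R y)" by (simp add: algebra_simps)
      also have "p \<dots> = c * p (x + t *\<^sub>R y)" using c by (intro sublinearD(2)[OF p]) auto
      finally show ?thesis using c by (simp add: field_simps)
    qed
    then have "?q (c *\<^sub>R x) / c \<le> ?q x" by (rule sublinear_lower_greatest)
    then show ?thesis using c by (simp add: field_simps)
  qed
  have "?q (c *\<^sub>R x) = c * ?q x" if c: "c \<ge> 0" for c x
  proof (cases "c = 0")
    case True
    have "?q 0 \<le> 0" using sublinear_lower_le[OF p, of 0 y 0] sublinearD(3)[OF p] by simp
    moreover have "0 \<le> ?q 0"
      by (rule sublinear_lower_greatest) (use sublinearD(2)[OF p] in auto)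
    ultimately show ?thesis using True by simp
  next
    case False
    with c have c: "c > 0" by simp
    have "?q x \<le> (1 / c) * ?q (c *\<^sub>R x)" using le[of "1 / c" "c *\<^sub>R x"] c by simp
    then show ?thesis using le[OF c, of x] c by (simp add: field_simps)
  qed
  with add show ?thesis by (auto simp: sublinear_def)
qed

text \<open>A sublinear functional that is minimal among the sublinear functionals below \<open>q\<close> is linear,
  because it cannot lie strictly above any of its \<^const>\<open>sublinear_lower\<close> modifications.\<close>

theorem hahn_banach_sublinear:
  fixes q :: "'b::real_vector \<Rightarrow> real"
  assumes q: "sublinear q"
  obtains u where "linear u" "\<And>x. u x \<le> q x"
proof -
  define A where "A = {p :: 'b \<Rightarrow> real. sublinear p \<and> (\<forall>x. p x \<le> q x)}"
  \<comment> \<open>The order is reversed, so that the maximal element given by Zorn's lemma is a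
    minimal functional.\<close>
  define P where "P = (\<lambda>a b :: 'b \<Rightarrow> real. \<forall>x. b x \<le> a x)"
  have "\<exists>m\<in>A. \<forall>a\<in>A. P m a \<longrightarrow> a = m"
  proof (rule predicate_Zorn)
    show "partial_order_on A (relation_of P A)"
      by (rule partial_order_on_relation_ofI) (auto simp: P_def fun_eq_iff intro: order.trans antisym)
    fix C assume C: "C \<in> Chains (relation_of P A)"
    show "\<exists>u\<in>A. \<forall>a\<in>C. P a u"
    proof (cases "C = {}")
      case True
      then show ?thesis using q by (auto simp: A_def)
    next
      case False
      have CA: "C \<subseteq> A" using C by (auto simp: Chains_def relation_of_def)
      have chain: "P a b \<or> P b a" if "a \<in> C" "b \<in> C" for a b
        using C that by (auto simp: Chains_def relation_of_def)
      have sub: "sublinear a" "a x \<le> q x" if "a \<in> C" for a x using that CA by (auto simp: A_def)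
      define u where "u = (\<lambda>x. INF a\<in>C. a x)"
      have bdd: "bdd_below ((\<lambda>a. a x) ` C)" for x
      proof (rule bdd_belowI2)
        fix a assume a: "a \<in> C"
        show "- q (- x) \<le> a x" using sublinearD(4)[OF sub(1)[OF a], of x] sub(2)[OF a, of "-x"] by linarith
      qed
      have u_le: "u x \<le> a x" if "a \<in> C" for a x
        unfolding u_def using that bdd by (intro cINF_lower) auto
      have u_ge: "c \<le> u x" if "\<And>a. a \<in> C \<Longrightarrow> c \<le> a x" for c x
        unfolding u_def using that False by (intro cINF_greatest) auto
      have "u (x + y) \<le> u x + u y" for x y
      proof -
        have "u (x + y) - b y \<le> a x" if ab: "a \<in> C" "b \<in> C" for a b
        proof -
          \<comment> \<open>The smaller of the two functionals serves at both points; this is how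
            the pointwise infimum over a chain inherits subadditivity.\<close>
          from chain[OF ab] obtain c where c: "c \<in> C" "c x \<le> a x" "c y \<le> b y"
            using ab by (auto simp: P_def)
          have "u (x + y) \<le> c (x + y)" by (rule u_le) fact
          also have "\<dots> \<le> c x + c y" by (rule sublinearD(1)) (use sub c in auto)
          finally show ?thesis using c by linarith
        qed
        then have "u (x + y) - b y \<le> u x" if "b \<in> C" for b using that by (intro u_ge) auto
        then have "u (x + y) - u x \<le> u y" by (intro u_ge) (auto simp: algebra_simps)
        then show ?thesis by simp
      qed
      moreover have "u (t *\<^sub>R x) = t * u x" if t: "t \<ge> 0" for t x
      proof (cases "t = 0")
        case True
        have zero: "a 0 = 0" if "a \<in> C" for a using sub(1)[OF that] by (rule sublinearD(3))
        obtain a where "a \<in> C" using \<open>C \<noteq> {}\<close> by auto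
        then have "u 0 \<le> 0" using u_le[of a 0] zero[of a] by simp
        moreover have "0 \<le> u 0" by (rule u_ge) (simp add: zero)
        ultimately have "u 0 = 0" by simp
        then show ?thesis using True by simp
      next
        case False
        with t have t: "t > 0" by simp
        have hom: "a (t *\<^sub>R x) = t * a x" if "a \<in> C" for a using sub(1)[OF that] t by (intro sublinearD(2)) auto
        have "u (t *\<^sub>R x) / t \<le> u x"
        proof (rule u_ge)
          fix a assume "a \<in> C"
          then show "u (t *\<^sub>R x) / t \<le> a x" using u_le[of a "t *\<^sub>R x"] hom[of a] t by (simp add: field_simps)
        qed
        moreover have "t * u x \<le> u (t *\<^sub>R x)"
        proof (rule u_ge)
          fix a assume "a \<in> C"
          then show "t * u x \<le> a (t *\<^sub>R x)" using u_le[of a x] hom[of a] t by simp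
        qed
        ultimately show ?thesis using t by (simp add: field_simps)
      qed
      moreover have "u x \<le> q x" for x using False u_le sub(2) by (metis ex_in_conv order.trans)
      ultimately have "u \<in> A" by (auto simp: A_def sublinear_def)
      then show ?thesis using u_le by (auto simp: P_def)
    qed
  qed
  then obtain m where m: "m \<in> A" and min: "\<And>a. a \<in> A \<Longrightarrow> P m a \<Longrightarrow> a = m" by auto
  have sm: "sublinear m" and mq: "m x \<le> q x" for x using m by (auto simp: A_def)
  have sup: "m x + m y \<le> m (x + y)" for x y
  proof -
    have le: "sublinear_lower m y x \<le> m x" for x using sublinear_lower_le[OF sm, of 0 y x] by simp
    then have "sublinear_lower m y \<in> A"
      using mq by (auto simp: A_def sublinear_sublinear_lower sm intro: order.trans)
    then have "sublinear_lower m y = m" by (rule min) (use le in \<open>auto simp: P_def\<close>)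
    then show ?thesis using sublinear_lower_le[OF sm, of 1 y x] by simp
  qed
  have add: "m (x + y) = m x + m y" for x y using sup sublinearD(1)[OF sm] by (intro antisym) auto
  have neg: "m (- x) = - m x" for x using add[of x "-x"] sublinearD(3)[OF sm] by simp
  have "m (t *\<^sub>R x) = t *\<^sub>R m x" for t x
  proof (cases "t \<ge> 0")
    case False
    then show ?thesis using sublinearD(2)[OF sm, of "-t" x] neg[of "t *\<^sub>R x"] by simp
  qed (use sublinearD(2)[OF sm] in auto)
  then have "linear m" by (intro linearI add)
  then show ?thesis using mq by (rule that)
qed

text \<open>No extension from a subspace is made. A linear functional below
  \<open>sublinear_lower norm x\<close> lies below the norm, and its value at \<open>- x\<close> is
  at most \<open>- norm x\<close>, which forces \<open>u x = norm x\<close>.\<close>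

corollary norming_functional:
  fixes x :: "'b::real_normed_vector"
  obtains u :: "'b \<Rightarrow> real" where "bounded_linear u" "u x = norm x" "\<And>y. \<bar>u y\<bar> \<le> norm y"
proof -
  have n: "sublinear (norm :: 'b \<Rightarrow> real)" by (simp add: sublinear_def norm_triangle_ineq)
  obtain u where u: "linear u" "\<And>y. u y \<le> sublinear_lower norm x y"
    using hahn_banach_sublinear[OF sublinear_sublinear_lower[OF n, of x]] by blast
  have le: "u y \<le> norm (y + t *\<^sub>R x) - t * norm x" if "t \<ge> 0" for y t
    using u(2)[of y] sublinear_lower_le[OF n that, of x y] by linarith
  have le_norm: "u y \<le> norm y" for y using le[of 0 y] by simp
  have abs: "\<bar>u y\<bar> \<le> norm y" for y
    using le_norm[of y] le_norm[of "-y"] linear_neg[OF u(1), of y] by simp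
  have "norm x \<le> u x" using le[of 1 "-x"] linear_neg[OF u(1), of x] by simp
  then have "u x = norm x" using le_norm[of x] by simp
  moreover have "bounded_linear u"
    using u(1) abs by (intro bounded_linear_intro[where K=1]) (auto simp: linear_add linear_scale)
  ultimately show ?thesis using that abs by blast
qed

section \<open>Symmetric resampling distributions\<close>

lemma integrable_measure_pmf_bounded:
  fixes f :: "'a \<Rightarrow> 'b::{banach, second_countable_topology}"
  assumes "\<And>x. x \<in> set_pmf Q \<Longrightarrow> norm (f x) \<le> B"
  shows "integrable (measure_pmf Q) f"
  using assms by (intro measure_pmf.integrable_const_bound[where B=B]) (auto simp: AE_measure_pmf_iff)

lemma integrable_measure_pmf_of_bool: "integrable (measure_pmf Q) (\<lambda>x. of_bool (P x) :: real)"
  by (rule integrable_measure_pmf_bounded[where B=1]) auto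

lemma integral_measure_pmf_mono:
  fixes f h :: "'a \<Rightarrow> real"
  assumes "integrable (measure_pmf Q) f" "integrable (measure_pmf Q) h"
    and "\<And>x. x \<in> set_pmf Q \<Longrightarrow> f x \<le> h x"
  shows "measure_pmf.expectation Q f \<le> measure_pmf.expectation Q h"
  using assms by (intro integral_mono_AE) (auto simp: AE_measure_pmf_iff)

lemma ex_permutes_image_eq:
  assumes "finite S" "B \<subseteq> S" "B' \<subseteq> S" "card B = card B'"
  obtains \<sigma> where "\<sigma> permutes S" "\<sigma> ` B = B'"
proof -
  have fin: "finite B" "finite B'" using assms finite_subset by auto
  obtain f where f: "bij_betw f B B'"
    using finite_same_card_bij[OF fin assms(4)] by auto
  have "card (S - B) = card (S - B')"
    using assms fin by (simp add: card_Diff_subset)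
  then obtain h where h: "bij_betw h (S - B) (S - B')"
    using finite_same_card_bij[of "S - B" "S - B'"] assms by auto
  define \<sigma> where "\<sigma> x = (if x \<in> B then f x else if x \<in> S then h x else x)" for x
  have 1: "bij_betw \<sigma> B B'" by (rule bij_betw_cong[THEN iffD1, OF _ f]) (simp add: \<sigma>_def)
  have 2: "bij_betw \<sigma> (S - B) (S - B')" by (rule bij_betw_cong[THEN iffD1, OF _ h]) (simp add: \<sigma>_def)
  have "bij_betw \<sigma> (B \<union> (S - B)) (B' \<union> (S - B'))"
    using 1 2 by (rule bij_betw_combine) auto
  then have "bij_betw \<sigma> S S" using assms by (simp add: Un_absorb1)
  then have "\<sigma> permutes S" by (rule bij_imp_permutes) (use assms in \<open>auto simp: \<sigma>_def\<close>)
  moreover have "\<sigma> ` B = B'" using 1 by (simp add: bij_betw_def)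
  ultimately show ?thesis by (rule that)
qed

lemma map_pmf_permutation:
  assumes supp: "set_pmf Q \<subseteq> seqs n" and sym: "symmetric_resampling n Q" and \<sigma>: "\<sigma> permutes {1..n}"
  shows "map_pmf (map \<sigma>) Q = Q"
proof (rule pmf_eqI)
  fix r
  define r' where "r' = map (inv \<sigma>) r"
  have r: "r = map \<sigma> r'"
    using permutes_inverses[OF \<sigma>] by (simp add: r'_def comp_def)
  have inj: "inj (map \<sigma>)" using \<sigma> by (simp add: permutes_inj)
  have "pmf Q r' = pmf Q (map \<sigma> r')"
  proof (cases "r' \<in> seqs n \<and> r' \<noteq> []")
    case True
    then show ?thesis using sym \<sigma> unfolding symmetric_resampling_def by blast
  next
    case False
    \<comment> \<open>The symmetry condition concerns nonempty sequences of valid indices. The empty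
      sequence is fixed by \<open>map \<sigma>\<close>; for any other list outside
      \<open>seqs n\<close>, both the list and its image have mass 0.\<close>
    have "map \<sigma> r' \<in> seqs n \<longleftrightarrow> r' \<in> seqs n"
      using permutes_in_image[OF \<sigma>] by (auto simp: seqs_def in_lists_conv_set)
    then have "r' \<notin> set_pmf Q \<and> map \<sigma> r' \<notin> set_pmf Q \<or> r' = []"
      using False supp by blast
    then show ?thesis by (auto simp: set_pmf_iff)
  qed
  then show "pmf (map_pmf (map \<sigma>) Q) r = pmf Q r"
    unfolding r using inj by (simp add: pmf_map_inj')
qed

lemma expectation_permutation:
  fixes F :: "nat list \<Rightarrow> 'b::{banach, second_countable_topology}"
  assumes "set_pmf Q \<subseteq> seqs n" "symmetric_resampling n Q" "\<sigma> permutes {1..n}"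
  shows "measure_pmf.expectation Q (\<lambda>r. F (map \<sigma> r)) = measure_pmf.expectation Q F"
  using map_pmf_permutation[OF assms] integral_map_pmf[of "map \<sigma>" Q F] by simp

text \<open>A symmetric resampling distribution gives equal mass to all bags with equally many distinct
  entries, so that the set of entries is a uniform subset once its size is fixed.\<close>

lemma symmetric_expectation_le:
  fixes F :: "nat set \<Rightarrow> real" and G :: "nat \<Rightarrow> real"
  assumes supp: "set_pmf Q \<subseteq> seqs n" and sym: "symmetric_resampling n Q"
    and FG: "\<And>m. m \<le> n \<Longrightarrow> (\<Sum>B | B \<subseteq> {1..n} \<and> card B = m. F B) \<le> real (n choose m) * G m"
  shows "measure_pmf.expectation Q (\<lambda>r. F (set r)) \<le> measure_pmf.expectation Q (\<lambda>r. G (card (set r)))"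
proof -
  define \<mu> where "\<mu> = map_pmf set Q"
  define u where "u m = pmf \<mu> {1..m}" for m
  have supp_\<mu>: "set_pmf \<mu> \<subseteq> Pow {1..n}"
    using supp by (auto simp: \<mu>_def seqs_def)
  have u: "pmf \<mu> B = u (card B)" if B: "B \<subseteq> {1..n}" for B
  proof -
    have "card B \<le> n" using card_mono[OF _ B] by simp
    then obtain \<sigma> where \<sigma>: "\<sigma> permutes {1..n}" "\<sigma> ` B = {1..card B}"
      using ex_permutes_image_eq[of "{1..n}" B "{1..card B}"] B by auto
    have "map_pmf (image \<sigma>) \<mu> = map_pmf set (map_pmf (map \<sigma>) Q)"
      by (simp add: \<mu>_def pmf.map_comp comp_def)
    then have "map_pmf (image \<sigma>) \<mu> = \<mu>"
      by (simp add: map_pmf_permutation[OF supp sym \<sigma>(1)] \<mu>_def)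
    moreover have "pmf (map_pmf (image \<sigma>) \<mu>) (\<sigma> ` B) = pmf \<mu> B"
      using \<sigma>(1) by (intro pmf_map_inj' injI) (simp add: inj_image_eq_iff permutes_inj)
    ultimately show ?thesis by (simp add: u_def \<sigma>(2))
  qed
  have ex: "measure_pmf.expectation Q (\<lambda>r. H (set r))
      = (\<Sum>m\<le>n. u m * (\<Sum>B | B \<subseteq> {1..n} \<and> card B = m. H B))" for H :: "nat set \<Rightarrow> real"
  proof -
    have "measure_pmf.expectation Q (\<lambda>r. H (set r)) = measure_pmf.expectation \<mu> H"
      by (simp add: \<mu>_def)
    also have "\<dots> = (\<Sum>B\<in>Pow {1..n}. H B * pmf \<mu> B)"
      using supp_\<mu> by (intro integral_measure_pmf_real) auto
    also have "\<dots> = (\<Sum>m\<le>n. \<Sum>B | B \<in> Pow {1..n} \<and> card B = m. H B * pmf \<mu> B)"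
      by (rule sum.group[symmetric]) (auto dest: card_mono[rotated])
    also have "\<dots> = (\<Sum>m\<le>n. u m * (\<Sum>B | B \<subseteq> {1..n} \<and> card B = m. H B))"
      unfolding sum_distrib_left
      by (intro sum.cong) (auto simp: u mult.commute)
    finally show ?thesis .
  qed
  have "measure_pmf.expectation Q (\<lambda>r. F (set r)) = (\<Sum>m\<le>n. u m * (\<Sum>B | B \<subseteq> {1..n} \<and> card B = m. F B))"
    by (rule ex)
  also have "\<dots> \<le> (\<Sum>m\<le>n. u m * (\<Sum>B | B \<subseteq> {1..n} \<and> card B = m. G (card B)))"
  proof (rule sum_mono, rule mult_left_mono)
    fix m assume m: "m \<in> {..n}"
    have eq: "(\<Sum>B | B \<subseteq> {1..n} \<and> card B = m. G (card B)) = real (n choose m) * G m"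
      using n_subsets[of "{1..n}" m] by simp
    show "(\<Sum>B | B \<subseteq> {1..n} \<and> card B = m. F B) \<le> (\<Sum>B | B \<subseteq> {1..n} \<and> card B = m. G (card B))"
      unfolding eq using m by (intro FG) simp
  qed (simp add: u_def)
  also have "\<dots> = measure_pmf.expectation Q (\<lambda>r. G (card (set r)))"
    by (rule ex[symmetric])
  finally show ?thesis .
qed

lemma expectation_mem_symmetric:
  assumes n: "n \<ge> 1" and supp: "set_pmf Q \<subseteq> seqs n" and sym: "symmetric_resampling n Q" and i: "i \<in> {1..n}"
  shows "measure_pmf.expectation Q (\<lambda>r. of_bool (i \<in> set r)) = inclusion_prob n Q"
proof -
  let ?E = "\<lambda>j. measure_pmf.expectation Q (\<lambda>r. of_bool (j \<in> set r) :: real)"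
  have eq: "?E j = ?E i" if j: "j \<in> {1..n}" for j
  proof -
    let ?\<sigma> = "Transposition.transpose i j"
    have \<sigma>: "?\<sigma> permutes {1..n}" using i j by (rule permutes_swap_id)
    have "?E i = measure_pmf.expectation Q (\<lambda>r. of_bool (i \<in> set (map ?\<sigma> r)))"
      by (rule expectation_permutation[OF supp sym \<sigma>, symmetric])
    also have "(\<lambda>r. i \<in> set (map ?\<sigma> r)) = (\<lambda>r. j \<in> set r)"
    proof
      fix r :: "nat list"
      show "i \<in> set (map ?\<sigma> r) \<longleftrightarrow> j \<in> set r"
        by (auto simp: Transposition.transpose_def)
    qed
    finally show ?thesis ..
  qed
  have "inclusion_prob n Q = (1 / real n) * (\<Sum>j=1..n. ?E j)"
    unfolding inclusion_prob_def
    by (subst integral_mult_right_zero, subst Bochner_Integration.integral_sum)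
       (auto intro!: integrable_measure_pmf_bounded[where B=1])
  also have "\<dots> = (1 / real n) * (\<Sum>j=1..n. ?E i)" using eq by simp
  finally show ?thesis using n by simp
qed

section \<open>Moments of the number of distinct entries of a bag\<close>

lemma inclusion_prob_nonneg: "0 \<le> inclusion_prob n Q"
  unfolding inclusion_prob_def by (intro integral_nonneg_AE AE_I2 mult_nonneg_nonneg sum_nonneg) auto

lemma expectation_abs_le_sqrt:
  fixes Y :: "'a \<Rightarrow> real"
  assumes Y: "\<And>x. x \<in> set_pmf Q \<Longrightarrow> \<bar>Y x\<bar> \<le> C"
    and v: "measure_pmf.expectation Q (\<lambda>x. (Y x)\<^sup>2) \<le> v"
  shows "measure_pmf.expectation Q (\<lambda>x. \<bar>Y x\<bar>) \<le> sqrt v"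
proof -
  have int: "integrable (measure_pmf Q) (\<lambda>x. (Y x)\<^sup>2)"
  proof (rule integrable_measure_pmf_bounded[where B="C\<^sup>2"])
    fix x assume "x \<in> set_pmf Q"
    then show "norm ((Y x)\<^sup>2) \<le> C\<^sup>2" using power_mono[OF Y, of x 2] by simp
  qed
  have intY: "integrable (measure_pmf Q) (\<lambda>x. \<bar>Y x\<bar>)"
    using Y by (intro integrable_measure_pmf_bounded[where B=C]) auto
  have "(measure_pmf.expectation Q (\<lambda>x. \<bar>Y x\<bar>))\<^sup>2 \<le> measure_pmf.expectation Q (\<lambda>x. \<bar>Y x\<bar>\<^sup>2)"
    using measure_pmf.variance_positive[of Q "\<lambda>x. \<bar>Y x\<bar>"] measure_pmf.variance_eq[OF intY] int by simp
  also have "\<dots> \<le> v" using v by simp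
  finally show ?thesis by (rule real_le_rsqrt)
qed

text \<open>Here the nonpositive covariances enter: the variance of the number of distinct entries
  is the sum of all covariances of the inclusion indicators, hence at most the sum of the
  \<open>n\<close> variances \<open>p * (1 - p)\<close>.\<close>

lemma expectation_abs_centered_count_le:
  assumes n: "n \<ge> 1" and supp: "set_pmf Q \<subseteq> seqs n" and sym: "symmetric_resampling n Q"
    and cov: "nonpositive_covariance n Q" and p: "p = inclusion_prob n Q"
  shows "measure_pmf.expectation Q (\<lambda>r. \<bar>real (card (set r)) - real n * p\<bar>) \<le> sqrt (real n * (p * (1 - p)))"
proof (rule expectation_abs_le_sqrt[where C="real n + real n * \<bar>p\<bar>"])
  fix r assume "r \<in> set_pmf Q"
  then have "set r \<subseteq> {1..n}" using supp by (auto simp: seqs_def)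
  then have "card (set r) \<le> n" using card_mono[of "{1..n}" "set r"] by simp
  moreover have "\<bar>real n * p\<bar> = real n * \<bar>p\<bar>" by (simp add: abs_mult)
  ultimately show "\<bar>real (card (set r)) - real n * p\<bar> \<le> real n + real n * \<bar>p\<bar>" by linarith
next
  define X where "X i r = of_bool (i \<in> set r) - p" for i and r :: "nat list"
  have EX: "measure_pmf.expectation Q (\<lambda>r. of_bool (i \<in> set r)) = p" if "i \<in> {1..n}" for i
    using expectation_mem_symmetric[OF n supp sym that] p by simp
  have bX: "\<bar>X i r\<bar> \<le> 1 + \<bar>p\<bar>" for i r by (auto simp: X_def)
  have int: "integrable (measure_pmf Q) (\<lambda>r. X i r * X j r)" for i j
    by (rule integrable_measure_pmf_bounded[where B="(1 + \<bar>p\<bar>) * (1 + \<bar>p\<bar>)"])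
      (auto simp: abs_mult intro!: mult_mono bX)
  have le: "measure_pmf.expectation Q (\<lambda>r. X i r * X j r) \<le> (if i = j then p * (1 - p) else 0)"
    if i: "i \<in> {1..n}" and j: "j \<in> {1..n}" for i j
  proof (cases "i = j")
    case True
    have "measure_pmf.expectation Q (\<lambda>r. X i r * X i r)
      = measure_pmf.expectation Q (\<lambda>r. (1 - 2 * p) * of_bool (i \<in> set r) + p\<^sup>2)"
      by (intro Bochner_Integration.integral_cong) (auto simp: X_def power2_eq_square algebra_simps)
    also have "\<dots> = (1 - 2 * p) * p + p\<^sup>2"
      by (simp add: integrable_measure_pmf_of_bool EX[OF i])
    finally show ?thesis using True by (simp add: power2_eq_square algebra_simps)
  next
    case False
    then have "covariance (measure_pmf Q) (\<lambda>r. of_bool (i \<in> set r)) (\<lambda>r. of_bool (j \<in> set r)) \<le> 0"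
      using cov i j by (auto simp: nonpositive_covariance_def)
    then show ?thesis using False by (simp add: covariance_def EX[OF i] EX[OF j] X_def)
  qed
  have "measure_pmf.expectation Q (\<lambda>r. (real (card (set r)) - real n * p)\<^sup>2)
    = measure_pmf.expectation Q (\<lambda>r. \<Sum>i=1..n. \<Sum>j=1..n. X i r * X j r)"
  proof (rule integral_cong_AE)
    show "AE r in measure_pmf Q. (real (card (set r)) - real n * p)\<^sup>2 = (\<Sum>i=1..n. \<Sum>j=1..n. X i r * X j r)"
      unfolding AE_measure_pmf_iff
    proof
      fix r assume "r \<in> set_pmf Q"
      then have "set r \<subseteq> {1..n}" using supp by (auto simp: seqs_def)
      then have "{1..n} \<inter> set r = set r" by auto
      then have "(\<Sum>i=1..n. X i r) = real (card (set r)) - real n * p"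
        by (simp add: X_def sum_subtractf sum.If_cases of_bool_def)
      then show "(real (card (set r)) - real n * p)\<^sup>2 = (\<Sum>i=1..n. \<Sum>j=1..n. X i r * X j r)"
        by (simp add: sum_product[symmetric] power2_eq_square)
    qed
  qed auto
  also have "\<dots> = (\<Sum>i=1..n. \<Sum>j=1..n. measure_pmf.expectation Q (\<lambda>r. X i r * X j r))"
    using int by simp
  also have "\<dots> \<le> (\<Sum>i=1..n. \<Sum>j=1..n. if i = j then p * (1 - p) else 0)"
    by (intro sum_mono le) auto
  also have "\<dots> = real n * (p * (1 - p))" by simp
  finally show "measure_pmf.expectation Q (\<lambda>r. (real (card (set r)) - real n * p)\<^sup>2) \<le> real n * (p * (1 - p))" .
qed

lemma expectation_card_set:
  assumes n: "n \<ge> 1" and supp: "set_pmf Q \<subseteq> seqs n"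
  shows "measure_pmf.expectation Q (\<lambda>r. real (card (set r)) / real n) = inclusion_prob n Q"
  unfolding inclusion_prob_def
proof (rule integral_cong_AE)
  show "AE r in measure_pmf Q. real (card (set r)) / real n = 1 / real n * (\<Sum>i=1..n. of_bool (i \<in> set r))"
    unfolding AE_measure_pmf_iff
  proof
    fix r assume "r \<in> set_pmf Q"
    then have "set r \<subseteq> {1..n}" using supp by (auto simp: seqs_def)
    then have "{1..n} \<inter> set r = set r" by auto
    then show "real (card (set r)) / real n = 1 / real n * (\<Sum>i=1..n. of_bool (i \<in> set r))"
      by (simp add: sum.If_cases of_bool_def)
  qed
qed auto

lemma expectation_abs_of_bool_centered:
  fixes p :: real
  assumes "measure_pmf.expectation Q (\<lambda>r. of_bool (P r)) = p" "0 \<le> p" "p \<le> 1"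
  shows "measure_pmf.expectation Q (\<lambda>r. \<bar>of_bool (P r) - p\<bar>) = 2 * p * (1 - p)"
proof -
  have "measure_pmf.expectation Q (\<lambda>r. \<bar>of_bool (P r) - p\<bar>)
    = measure_pmf.expectation Q (\<lambda>r. (1 - 2 * p) * of_bool (P r) + p)"
    using assms(2,3) by (intro Bochner_Integration.integral_cong) (auto simp: of_bool_def)
  also have "\<dots> = (1 - 2 * p) * p + p"
    by (simp add: integrable_measure_pmf_of_bool assms(1))
  finally show ?thesis by (simp add: algebra_simps)
qed

section \<open>Maximal inequality for a random bag\<close>

text \<open>Expresses the excess of \<open>hoeffding_factor\<close> over 1 through
  \<open>eta\<close>. The factor 3 comes from \<open>harm n\<close> being at least 3/2, so that
  \<open>harm n\<close> is at most \<open>3 * (harm n - 1)\<close>.\<close>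

lemma eta_lower_bound:
  assumes "n \<ge> 2"
  shows "eta n \<ge> 0" "harm n / real n \<le> 3 * eta n"
proof -
  have h: "harm n \<ge> (3 / 2 :: real)"
    using harm_mono[OF assms, where 'a=real] by (simp add: harm_def numeral_2_eq_2)
  have lt: "harm n < real n"
  proof -
    have "harm n = (\<Sum>k=1..n. inverse (real k))" by (simp add: harm_def)
    also have "\<dots> < (\<Sum>k=1..n. 1)"
    proof (rule sum_strict_mono_ex1)
      show "\<exists>k\<in>{1..n}. inverse (real k) < 1" using assms by (intro bexI[of _ 2]) auto
    qed (auto simp: inverse_le_1_iff)
    finally show ?thesis by simp
  qed
  show "eta n \<ge> 0" unfolding eta_def using h lt by (intro divide_nonneg_nonneg) auto
  have n: "real n > 0" using assms by simp
  have "harm n / real n \<le> 3 * ((harm n - 1) / real n)"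
    using h n by (simp add: field_simps)
  also have "(harm n - 1) / real n \<le> eta n"
    unfolding eta_def using h lt by (intro divide_left_mono) (auto intro!: mult_pos_pos)
  finally show "harm n / real n \<le> 3 * eta n" by simp
qed

lemma symmetric_expected_max_deviation_le:
  fixes w :: "'k \<Rightarrow> nat \<Rightarrow> real"
  assumes n: "n \<ge> 2" and supp: "set_pmf Q \<subseteq> seqs n" and sym: "symmetric_resampling n Q"
    and p: "p = inclusion_prob n Q" "0 < p" "p < 1"
    and I: "finite I" "I \<noteq> {}"
    and w: "\<And>k. k \<in> I \<Longrightarrow> (\<Sum>i=1..n. (w k i)\<^sup>2) \<le> 1"
    and wb: "\<And>k i. p < 1 / 5 \<or> 4 / 5 < p \<Longrightarrow> k \<in> I \<Longrightarrow> i \<in> {1..n} \<Longrightarrow>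
      \<bar>w k i\<bar> \<le> sqrt (p * (1 - p) / (16 / 5 * ln (2 * real (card I))))"
  shows "measure_pmf.expectation Q (\<lambda>r. MAX k\<in>I. \<bar>sampling_deviation {1..n} (w k) (set r)\<bar>)
    \<le> sqrt (16 / 5 * (1 + eta n) * ln (2 * real (card I)) * (p * (1 - p) + 4 * eta n))"
proof -
  define L where "L = ln (2 * real (card I))"
  define M where "M B = (MAX k\<in>I. \<bar>sampling_deviation {1..n} (w k) B\<bar>)" for B
  define e where "e = eta n"
  have "real (card I) \<ge> 1" using I by (simp add: Suc_leI card_gt_0_iff)
  then have L: "L > 0" by (simp add: L_def)
  have e: "e \<ge> 0" using eta_lower_bound[OF n] by (simp add: e_def)
  have S: "finite {1..n}" "{1..n} \<noteq> {}" using n by auto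
  have "measure_pmf.expectation Q (\<lambda>r. M (set r)) \<le> sqrt (16 / 5 * (1 + e) * L * (p * (1 - p) + 4 * e))"
  proof (cases "p < 1 / 5 \<or> 4 / 5 < p")
    case False
    have "measure_pmf.expectation Q (\<lambda>r. M (set r))
      \<le> measure_pmf.expectation Q (\<lambda>r. sqrt (L * hoeffding_factor n / 2))"
      using expected_max_sampling_deviation_hoeffding[OF S I w]
      by (intro symmetric_expectation_le[OF supp sym]) (simp add: M_def L_def)
    also have "\<dots> = sqrt (L * hoeffding_factor n / 2)" by simp
    also have "\<dots> \<le> sqrt (16 / 5 * (1 + e) * L * (p * (1 - p) + 4 * e))"
    proof (rule real_sqrt_le_mono)
      have "0 \<le> (p - 1 / 5) * (4 / 5 - p)" using False by (intro mult_nonneg_nonneg) auto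
      also have "(p - 1 / 5) * (4 / 5 - p) = p * (1 - p) - 4 / 25" by (simp add: field_simps)
      finally have pq: "p * (1 - p) \<ge> 4 / 25" by simp
      \<comment> \<open>On this range \<open>p * (1 - p)\<close> is at least its endpoint value
        4/25, and \<open>16 / 5 * (4 / 25)\<close> is 64/125, just above the leading term
        1/2.\<close>
      have "hoeffding_factor n / 2 \<le> 1 / 2 + 3 * e"
        using eta_lower_bound(2)[OF n] by (simp add: hoeffding_factor_def e_def)
      also have "\<dots> \<le> 16 / 5 * (4 / 25 + 4 * e)" using e by simp
      also have "\<dots> \<le> 16 / 5 * (p * (1 - p) + 4 * e)" using pq by simp
      also have "\<dots> = 16 / 5 * (1 * (p * (1 - p) + 4 * e))" by simp
      also have "\<dots> \<le> 16 / 5 * ((1 + e) * (p * (1 - p) + 4 * e))"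
        using e pq by (intro mult_left_mono mult_right_mono) auto
      finally have "L * (hoeffding_factor n / 2) \<le> L * (16 / 5 * ((1 + e) * (p * (1 - p) + 4 * e)))"
        using L by (intro mult_left_mono) auto
      then show "L * hoeffding_factor n / 2 \<le> 16 / 5 * (1 + e) * L * (p * (1 - p) + 4 * e)"
        by (simp only: mult_ac times_divide_eq_right)
    qed
    finally show ?thesis .
  next
    case True
    define t where "t = (if p < 1 / 5 then p else 1 - p)"
    define b where "b = sqrt (p * (1 - p) / (16 / 5 * L))"
    have t: "0 < t" "t \<le> 1 / 5" "t * (1 - t) = p * (1 - p)"
      using True p by (auto simp: t_def)
    have b: "b > 0" and b2: "b\<^sup>2 = p * (1 - p) / (16 / 5 * L)"
      using p L by (auto simp: b_def)
    have wb': "\<bar>w k i\<bar> \<le> b" if "k \<in> I" "i \<in> {1..n}" for k i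
      using wb[OF True that] by (simp add: b_def L_def)
    define X where "X r = real (card (set r)) / real n" for r :: "nat list"
    have Ep: "measure_pmf.expectation Q X = p"
      unfolding X_def p(1) by (rule expectation_card_set[OF _ supp]) (use n in simp)
    \<comment> \<open>A non-integrable function would have integral 0, but the integral is
      \<open>p > 0\<close>.\<close>
    then have int: "integrable (measure_pmf Q) X"
      using p(2) not_integrable_integral_eq by fastforce
    \<comment> \<open>The Bernstein bounds are affine in the size of the bag, so averaging over the
      size only replaces the sampling fraction by \<open>p\<close>.\<close>
    have affine: "measure_pmf.expectation Q (\<lambda>r. a * (L + c * X r)) = a * (L + c * p)"
      "measure_pmf.expectation Q (\<lambda>r. a * (L + c * (1 - X r))) = a * (L + c * (1 - p))" for a c
      using int by (simp_all add: Ep)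
    have "measure_pmf.expectation Q (\<lambda>r. M (set r)) \<le> 5 * b / 3 * (L + 23 / 100 / b\<^sup>2 * t)"
    proof (cases "p < 1 / 5")
      case True
      have "measure_pmf.expectation Q (\<lambda>r. M (set r)) \<le> measure_pmf.expectation Q
          (\<lambda>r. 5 * b / 3 * (L + 23 / 100 / b\<^sup>2 * X r))"
        using expected_max_sampling_deviation_bernstein[OF S _ I b w wb']
        unfolding X_def by (intro symmetric_expectation_le[OF supp sym]) (simp add: M_def L_def)
      also have "\<dots> = 5 * b / 3 * (L + 23 / 100 / b\<^sup>2 * p)"
        by (rule affine)
      finally show ?thesis using True by (simp add: t_def)
    next
      case False
      have "measure_pmf.expectation Q (\<lambda>r. M (set r)) \<le> measure_pmf.expectation Q
          (\<lambda>r. 5 * b / 3 * (L + 23 / 100 / b\<^sup>2 * (1 - X r)))"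
        using expected_max_sampling_deviation_bernstein_Compl[OF S _ I b w wb']
        unfolding X_def by (intro symmetric_expectation_le[OF supp sym]) (simp add: M_def L_def)
      also have "\<dots> = 5 * b / 3 * (L + 23 / 100 / b\<^sup>2 * (1 - p))"
        by (rule affine)
      finally show ?thesis using False by (simp add: t_def)
    qed
    \<comment> \<open>Since \<open>1 - t\<close> is at least 4/5, this is at most
      \<open>23 / 25 * L\<close>. The bracket is then at most \<open>48 / 25 * L\<close>, and the
      factor \<open>5 * b / 3\<close> turns it into \<open>16 / 5 * b * L\<close>.\<close>
    also have "23 / 100 / b\<^sup>2 * t = 92 / 125 * L / (1 - t)"
      using t L unfolding b2 t(3)[symmetric] by (simp add: divide_simps)
    also have "5 * b / 3 * (L + 92 / 125 * L / (1 - t)) \<le> 5 * b / 3 * (L + 92 / 125 * L / (4 / 5))"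
      using t b L by (intro mult_left_mono add_left_mono divide_left_mono) auto
    also have "\<dots> = sqrt ((16 / 5 * b * L)\<^sup>2)"
      using b L by (simp add: algebra_simps)
    also have "(16 / 5 * b * L)\<^sup>2 = 16 / 5 * L * (p * (1 - p))"
      unfolding power_mult_distrib b2 using L by (simp add: power2_eq_square)
    also have "sqrt (16 / 5 * L * (p * (1 - p))) \<le> sqrt (16 / 5 * (1 + e) * L * (p * (1 - p) + 4 * e))"
    proof (rule real_sqrt_le_mono)
      have "1 * (p * (1 - p)) \<le> (1 + e) * (p * (1 - p) + 4 * e)"
        using e p by (intro mult_mono) auto
      then have "16 / 5 * L * (p * (1 - p)) \<le> 16 / 5 * L * ((1 + e) * (p * (1 - p) + 4 * e))"
        using L by (intro mult_left_mono) auto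
      then show "16 / 5 * L * (p * (1 - p)) \<le> 16 / 5 * (1 + e) * L * (p * (1 - p) + 4 * e)"
        by (simp only: mult_ac)
    qed
    finally show ?thesis .
  qed
  then show ?thesis by (simp add: M_def L_def e_def)
qed

lemma norm_expectation_le:
  fixes f :: "'a \<Rightarrow> 'b::{banach, second_countable_topology}"
  assumes "integrable (measure_pmf Q) f" "integrable (measure_pmf Q) h"
    and "\<And>x. x \<in> set_pmf Q \<Longrightarrow> norm (f x) \<le> h x"
  shows "norm (measure_pmf.expectation Q f) \<le> measure_pmf.expectation Q h"
proof -
  have "norm (measure_pmf.expectation Q f) \<le> measure_pmf.expectation Q (\<lambda>x. norm (f x))"
    by (rule integral_norm_bound)
  also have "\<dots> \<le> measure_pmf.expectation Q h"
    using assms by (intro integral_measure_pmf_mono) auto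
  finally show ?thesis .
qed

section \<open>Leave-one-out differences\<close>

text \<open>With \<open>g\<close> the mean output on a bag, \<open>loo_mean i\<close> is the bagged output without data point \<open>i\<close>:
  it is the conditional expectation of \<open>g\<close> given that \<open>i\<close> is not in the bag.\<close>

locale resampled_mean =
  fixes n :: nat and Q :: "nat list pmf" and p :: real
    and g :: "nat list \<Rightarrow> 'b::{banach, second_countable_topology}" and R :: real
  assumes n: "n \<ge> 2" and supp: "set_pmf Q \<subseteq> seqs n" and sym: "symmetric_resampling n Q"
    and cov: "nonpositive_covariance n Q"
    and p_def: "p = inclusion_prob n Q" and p1: "p < 1"
    and diam: "\<And>r r'. norm (g r - g r') \<le> R"
begin

abbreviation E :: "(nat list \<Rightarrow> 'c::{banach, second_countable_topology}) \<Rightarrow> 'c" where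
  "E \<equiv> measure_pmf.expectation Q"

definition loo_mean :: "nat \<Rightarrow> 'b" where
  "loo_mean i = (1 / (1 - p)) *\<^sub>R E (\<lambda>r. of_bool (i \<notin> set r) *\<^sub>R g r)"

definition \<Delta> :: "nat \<Rightarrow> 'b" where
  "\<Delta> i = E g - loo_mean i"

lemma p0: "0 \<le> p"
  using inclusion_prob_nonneg by (simp add: p_def)

lemma E_mem: "i \<in> {1..n} \<Longrightarrow> E (\<lambda>r. of_bool (i \<in> set r)) = p"
  using expectation_mem_symmetric[OF _ supp sym] n by (simp add: p_def)

lemma g_bounded: "norm (g r) \<le> R + norm (g [])"
  using diam[of r "[]"] norm_triangle_sub[of "g r" "g []"] by linarith

lemma integrable_scaled:
  assumes "\<And>r. \<bar>h r\<bar> \<le> C"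
  shows "integrable (measure_pmf Q) (\<lambda>r. h r *\<^sub>R g r)"
proof -
  have "0 \<le> C" using assms[of "[]"] by linarith
  then show ?thesis
    using g_bounded assms by (intro integrable_measure_pmf_bounded[where B="C * (R + norm (g []))"]) (auto intro!: mult_mono)
qed

lemma integrable_g: "integrable (measure_pmf Q) g"
  using integrable_scaled[of "\<lambda>_. 1" 1] by simp

lemma integrable_mem: "integrable (measure_pmf Q) (\<lambda>r. of_bool (P r) *\<^sub>R g r)"
  by (rule integrable_scaled[where C=1]) auto

text \<open>The centred indicator of \<open>i\<close> being in the bag is \<open>1 - p\<close> minus
  the indicator of the opposite event, which produces the two means in \<open>\<Delta> i\<close>. It
  has mean 0, so any constant \<open>w\<close> may be subtracted from \<open>g\<close>.\<close>

lemma \<Delta>_covariance: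
  assumes i: "i \<in> {1..n}"
  shows "(1 - p) *\<^sub>R \<Delta> i = E (\<lambda>r. (of_bool (i \<in> set r) - p) *\<^sub>R (g r - w))"
proof -
  have "E (\<lambda>r. (of_bool (i \<in> set r) - p) *\<^sub>R (g r - w))
    = E (\<lambda>r. (1 - p) *\<^sub>R g r - of_bool (i \<notin> set r) *\<^sub>R g r - (of_bool (i \<in> set r) - p) *\<^sub>R w)"
    by (intro Bochner_Integration.integral_cong) (auto simp: algebra_simps)
  also have "\<dots> = (1 - p) *\<^sub>R E g - E (\<lambda>r. of_bool (i \<notin> set r) *\<^sub>R g r) - (p - p) *\<^sub>R w"
    using integrable_g integrable_mem[of "\<lambda>r. i \<notin> set r"] integrable_measure_pmf_of_bool[of Q "\<lambda>r. i \<in> set r"]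
    by (simp add: E_mem[OF i])
  finally show ?thesis using p1 by (simp add: \<Delta>_def loo_mean_def scaleR_diff_right)
qed

text \<open>Bags without \<open>i\<close> cancel: \<open>\<Delta> i\<close> is the integral of
  \<open>g - loo_mean i\<close> over the bags that contain \<open>i\<close>, an event of probability
  \<open>p\<close>. As \<open>loo_mean i\<close> is an average of values of \<open>g\<close>, each
  difference has norm at most \<open>R\<close>.\<close>

lemma norm_\<Delta>_le:
  assumes i: "i \<in> {1..n}"
  shows "norm (\<Delta> i) \<le> p * R"
proof -
  define c where "c = loo_mean i"
  have Enot: "E (\<lambda>r. of_bool (i \<notin> set r)) = 1 - p"
  proof -
    have "E (\<lambda>r. of_bool (i \<notin> set r)) = E (\<lambda>r. 1 - of_bool (i \<in> set r))"
      by (intro Bochner_Integration.integral_cong) auto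
    also have "\<dots> = 1 - p" using E_mem[OF i] by (simp add: integrable_measure_pmf_of_bool)
    finally show ?thesis .
  qed
  have c: "(1 - p) *\<^sub>R c = E (\<lambda>r. of_bool (i \<notin> set r) *\<^sub>R g r)"
    using p1 by (simp add: c_def loo_mean_def)
  have gc: "norm (g r - c) \<le> R" for r
  proof -
    have "(1 - p) *\<^sub>R (g r - c) = E (\<lambda>r'. of_bool (i \<notin> set r') *\<^sub>R g r - of_bool (i \<notin> set r') *\<^sub>R g r')"
      using integrable_mem[of "\<lambda>r. i \<notin> set r"] by (simp add: integrable_measure_pmf_of_bool Enot scaleR_diff_right c)
    also have "norm \<dots> \<le> E (\<lambda>r'. of_bool (i \<notin> set r') * R)"
      using integrable_mem[of "\<lambda>r. i \<notin> set r"] diam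
      by (intro norm_expectation_le) (auto simp: integrable_measure_pmf_of_bool)
    also have "\<dots> = (1 - p) * R" by (simp add: integrable_measure_pmf_of_bool Enot)
    finally show ?thesis using p1 by simp
  qed
  have "\<Delta> i = E (\<lambda>r. of_bool (i \<in> set r) *\<^sub>R (g r - c))"
  proof -
    have "E (\<lambda>r. of_bool (i \<in> set r) *\<^sub>R (g r - c))
      = E (\<lambda>r. g r - of_bool (i \<notin> set r) *\<^sub>R g r - of_bool (i \<in> set r) *\<^sub>R c)"
      by (intro Bochner_Integration.integral_cong) auto
    also have "\<dots> = E g - (1 - p) *\<^sub>R c - p *\<^sub>R c"
      using integrable_g integrable_mem[of "\<lambda>r. i \<notin> set r"]
      by (simp add: integrable_measure_pmf_of_bool E_mem[OF i] c)
    also have "\<dots> = E g - c" by (simp add: algebra_simps)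
    finally show ?thesis by (simp add: \<Delta>_def c_def)
  qed
  also have "norm \<dots> \<le> E (\<lambda>r. of_bool (i \<in> set r) * R)"
    using gc integrable_g integrable_mem[of "\<lambda>r. i \<in> set r"]
    by (intro norm_expectation_le) (auto simp: integrable_measure_pmf_of_bool scaleR_diff_right)
  also have "\<dots> = p * R" by (simp add: integrable_measure_pmf_of_bool E_mem[OF i])
  finally show ?thesis .
qed

end

section \<open>The mean-square bound\<close>

text \<open>Division by \<open>(1 - p) * sqrt n\<close> turns the hypothesis into the claimed form.
  The constant 16/5 splits as 1.6 times 2; to pull \<open>q = sqrt 1.6\<close> out of the whole
  bracket, the other two summands are enlarged by \<open>q\<close> as well.\<close>

lemma stability_bound_arith:
  fixes n p R \<rho> e L N :: real
  assumes n: "n > 0" and p: "0 \<le> p" "p < 1" and nn: "R \<ge> 0" "\<rho> \<ge> 0" "e \<ge> 0" "L \<ge> 0" "N \<ge> 0"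
    and le: "(1 - p) * N \<le> R * (sqrt (16 / 5 * (1 + e) * L * (p * (1 - p) + 4 * e)) + sqrt (p * (1 - p)))
      + \<rho> * (sqrt n * (2 * p * (1 - p)))"
  shows "N\<^sup>2 / n \<le> 1.6 * (R * sqrt (2 * (1 + e) * L / n * (p / (1 - p) + 4 * e / (1 - p)\<^sup>2))
    + R * sqrt (1 / n * (p / (1 - p))) + 2 * \<rho> * p)\<^sup>2"
proof -
  define T1 where "T1 = sqrt (2 * (1 + e) * L / n * (p / (1 - p) + 4 * e / (1 - p)\<^sup>2))"
  define T2 where "T2 = sqrt (1 / n * (p / (1 - p)))"
  define Z where "Z = R * T1 + R * T2 + 2 * \<rho> * p"
  define s where "s = (1 - p) * sqrt n"
  define q where "q = sqrt (1.6 :: real)"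
  have q: "q \<ge> 1" "q\<^sup>2 = 1.6" by (auto simp: q_def)
  have "s > 0" using n p by (simp add: s_def)
  moreover have "s\<^sup>2 = (1 - p)\<^sup>2 * n" using n by (simp add: s_def power_mult_distrib)
  moreover have "sqrt (s\<^sup>2) = s" using \<open>s > 0\<close> by simp
  ultimately have s: "s > 0" "sqrt (s\<^sup>2) = s" "s\<^sup>2 = (1 - p)\<^sup>2 * n" by blast+
  have T: "T1 \<ge> 0" "T2 \<ge> 0" using nn p n by (auto simp: T1_def T2_def)
  have "sqrt (16 / 5 * (1 + e) * L * (p * (1 - p) + 4 * e)) = q * (s * T1)"
  proof -
    have "q * (s * T1) = sqrt (1.6 * (s\<^sup>2 * (2 * (1 + e) * L / n * (p / (1 - p) + 4 * e / (1 - p)\<^sup>2))))"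
      unfolding q_def T1_def by (simp only: real_sqrt_mult s(2))
    also have "1.6 * (s\<^sup>2 * (2 * (1 + e) * L / n * (p / (1 - p) + 4 * e / (1 - p)\<^sup>2)))
        = 16 / 5 * (1 + e) * L * ((1 - p)\<^sup>2 * (p / (1 - p) + 4 * e / (1 - p)\<^sup>2))"
      unfolding s(3) using n by simp
    also have "(1 - p)\<^sup>2 * (p / (1 - p) + 4 * e / (1 - p)\<^sup>2) = p * (1 - p) + 4 * e"
      using p by (simp add: distrib_left power2_eq_square)
    finally show ?thesis ..
  qed
  moreover have "sqrt (p * (1 - p)) = s * T2"
  proof -
    have "s * T2 = sqrt (s\<^sup>2 * (1 / n * (p / (1 - p))))"
      unfolding T2_def by (simp only: real_sqrt_mult s(2))
    also have "s\<^sup>2 * (1 / n * (p / (1 - p))) = p * (1 - p)"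
      unfolding s(3) using n p by (simp add: power2_eq_square)
    finally show ?thesis ..
  qed
  ultimately have "(1 - p) * N \<le> R * (q * (s * T1) + s * T2) + 2 * \<rho> * p * s"
    using le by (simp add: s_def mult_ac)
  also have "\<dots> \<le> R * (q * (s * T1) + q * (s * T2)) + q * (2 * \<rho> * p * s)"
  proof -
    have "x \<le> q * x" if "x \<ge> 0" for x using mult_right_mono[OF q(1) that] by simp
    then show ?thesis
      using nn s(1) T p by (intro add_mono mult_left_mono add_left_mono) simp_all
  qed
  also have "\<dots> = (1 - p) * (q * sqrt n * Z)" by (simp add: Z_def s_def algebra_simps)
  finally have "N \<le> q * sqrt n * Z" using p by simp
  then have "N\<^sup>2 \<le> (q * sqrt n * Z)\<^sup>2" using nn by (intro power_mono) auto
  also have "\<dots> = 1.6 * n * Z\<^sup>2" using n q by (simp add: power_mult_distrib)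
  finally show ?thesis using n by (simp add: Z_def T1_def T2_def field_simps)
qed

context resampled_mean
begin

text \<open>The hypothesis \<open>approx\<close> is the dual form of the approximation by
  combinations of the \<open>v k\<close>. In this form it passes from single outputs to their mean
  over the seed, since only a linear functional has to be integrated.\<close>

theorem mean_square_\<Delta>_le:
  fixes v :: "nat \<Rightarrow> 'b" and \<rho> :: real and w0 :: 'b
  assumes K: "K \<ge> 1" and R: "R \<ge> 0" and \<rho>: "\<rho> \<ge> 0"
    and v: "\<And>k. k \<in> {1..K} \<Longrightarrow> norm (v k) = 1"
    and approx: "\<And>u :: 'b \<Rightarrow> real. \<And>B M r. bounded_linear u \<Longrightarrow> (\<And>x. \<bar>u x\<bar> \<le> B * norm x) \<Longrightarrow>
      (\<And>k. k \<in> {1..K} \<Longrightarrow> \<bar>u (v k)\<bar> \<le> M) \<Longrightarrow> u (g r - w0) \<le> R * M + \<rho> * B"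
  shows "1 / real n * (\<Sum>i=1..n. (norm (\<Delta> i))\<^sup>2)
    \<le> 1.6 * (R * sqrt (2 * (1 + eta n) * ln (2 * real K) / real n * (p / (1 - p) + 4 * eta n / (1 - p)\<^sup>2))
      + R * sqrt (1 / real n * (p / (1 - p))) + 2 * \<rho> * p)\<^sup>2"
proof -
  define N where "N = sqrt (\<Sum>i=1..n. (norm (\<Delta> i))\<^sup>2)"
  define L where "L = ln (2 * real K)"
  have L: "L > 0" using K by (simp add: L_def)
  have N0: "N \<ge> 0" and N2: "N\<^sup>2 = (\<Sum>i=1..n. (norm (\<Delta> i))\<^sup>2)" by (auto simp: N_def sum_nonneg)
  show ?thesis
  proof (cases "N = 0")
    case True
    then show ?thesis using N2 by simp
  next
    case False
    with N0 have N: "N > 0" by simp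
    have p: "0 < p"
    proof (rule ccontr)
      assume "\<not> 0 < p"
      then have "p = 0" using p0 by simp
      then have "norm (\<Delta> i) = 0" if "i \<in> {1..n}" for i using norm_\<Delta>_le[OF that] by simp
      then have "N = 0" by (simp add: N_def)
      with False show False ..
    qed
    have "\<exists>u :: 'b \<Rightarrow> real. bounded_linear u \<and> u (\<Delta> i) = norm (\<Delta> i) \<and> (\<forall>y. \<bar>u y\<bar> \<le> norm y)" for i
      by (rule norming_functional[of "\<Delta> i"]) blast
    then obtain u :: "nat \<Rightarrow> 'b \<Rightarrow> real" where u: "\<And>i. bounded_linear (u i)"
      "\<And>i. u i (\<Delta> i) = norm (\<Delta> i)" "\<And>i y. \<bar>u i y\<bar> \<le> norm y" by metis
    define a where "a i = norm (\<Delta> i) / N" for i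
    have a0: "a i \<ge> 0" for i using N by (simp add: a_def)
    have a1: "(\<Sum>i=1..n. (a i)\<^sup>2) = 1"
    proof -
      have "(\<Sum>i=1..n. (a i)\<^sup>2) = N\<^sup>2 / N\<^sup>2"
        unfolding a_def power_divide sum_divide_distrib[symmetric] N2 ..
      then show ?thesis using N by simp
    qed
    have l1: "\<bar>\<Sum>i=1..n. x i\<bar> \<le> sqrt (real n)" if "(\<Sum>i=1..n. (x i)\<^sup>2) \<le> 1" for x :: "nat \<Rightarrow> real"
    proof -
      have "(\<Sum>i=1..n. x i * 1)\<^sup>2 \<le> (\<Sum>i=1..n. (x i)\<^sup>2) * (\<Sum>i=1..n. 1\<^sup>2)"
        by (rule Cauchy_Schwarz_ineq_sum)
      also have "\<dots> \<le> 1 * real n" using that by (intro mult_mono) auto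
      finally show ?thesis by (intro real_le_rsqrt) simp
    qed
    define w where "w k i = a i * u i (v k)" for k i
    have wa: "\<bar>w k i\<bar> \<le> a i" if "k \<in> {1..K}" for k i
      using u(3)[of i "v k"] v[OF that] a0[of i] by (simp add: w_def abs_mult mult_left_le)
    have w1: "(\<Sum>i=1..n. (w k i)\<^sup>2) \<le> 1" if "k \<in> {1..K}" for k
    proof -
      have "(w k i)\<^sup>2 \<le> (a i)\<^sup>2" for i using power_mono[OF wa[OF that], of i 2] by simp
      then show ?thesis unfolding a1[symmetric] by (intro sum_mono)
    qed
    define X where "X i r = of_bool (i \<in> set r) - p" for i and r :: "nat list"
    have X1: "\<bar>X i r\<bar> \<le> 1" for i r using p0 p1 by (auto simp: X_def)
    define M where "M r = (MAX k\<in>{1..K}. \<bar>sampling_deviation {1..n} (w k) (set r)\<bar>)" for r :: "nat list"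
    define Y where "Y r = \<bar>real (card (set r)) - real n * p\<bar>" for r :: "nat list"
    \<comment> \<open>The random functional whose mean value at \<open>g - w0\<close> is
      \<open>(1 - p) * N\<close>. Its values at the \<open>v k\<close> are governed by sampling
      deviations; the bound on its norm produces the term with \<open>\<rho>\<close>.\<close>
    define U where "U r x = (\<Sum>i=1..n. a i * X i r * u i x)" for r x
    have U_lin: "bounded_linear (U r)" for r
      unfolding U_def by (intro bounded_linear_sum bounded_linear_const_mult u(1))
    have U_norm: "\<bar>U r x\<bar> \<le> (\<Sum>i=1..n. a i * \<bar>X i r\<bar>) * norm x" for r x
    proof -
      have "\<bar>U r x\<bar> \<le> (\<Sum>i=1..n. \<bar>a i * X i r * u i x\<bar>)" unfolding U_def by (rule sum_abs)
      also have "\<dots> \<le> (\<Sum>i=1..n. a i * \<bar>X i r\<bar> * norm x)"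
        using a0 u(3) by (intro sum_mono) (auto simp: abs_mult intro!: mult_left_mono)
      finally show ?thesis by (simp add: sum_distrib_right)
    qed
    have n0: "real n > 0" using n by simp
    have U_v: "\<bar>U r (v k)\<bar> \<le> M r + Y r / sqrt (real n)" if r: "r \<in> set_pmf Q" and k: "k \<in> {1..K}" for r k
    proof -
      have sub: "set r \<subseteq> {1..n}" using supp r by (auto simp: seqs_def)
      have "U r (v k) = (\<Sum>i=1..n. w k i * of_bool (i \<in> set r) - p * w k i)"
        unfolding U_def X_def w_def by (intro sum.cong refl) (simp add: algebra_simps)
      also have "\<dots> = (\<Sum>i=1..n. w k i * of_bool (i \<in> set r)) - p * (\<Sum>i=1..n. w k i)"
        by (simp add: sum_subtractf sum_distrib_left)
      also have "(\<Sum>i=1..n. w k i * of_bool (i \<in> set r)) = (\<Sum>i\<in>set r. w k i)"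
        using sub by (intro sum.mono_neutral_cong_right) auto
      \<comment> \<open>Recentres at the empirical frequency. The price is the fluctuation of the
        bag size times the mean weight, and by Cauchy-Schwarz the sum of the weights is at most
        \<open>sqrt (real n)\<close> in absolute value.\<close>
      also have "(\<Sum>i\<in>set r. w k i) - p * (\<Sum>i=1..n. w k i) = sampling_deviation {1..n} (w k) (set r)
          + (real (card (set r)) - real n * p) / real n * (\<Sum>i=1..n. w k i)"
      proof -
        have alg: "A - p * W = A - c * (W / real n) + (c - real n * p) / real n * W" for A W c :: real
          using n0 by (simp add: field_simps)
        have card: "real (card {1..n}) = real n" by simp
        show ?thesis unfolding sampling_deviation_def card by (rule alg)
      qed
      finally have "\<bar>U r (v k)\<bar> \<le> \<bar>sampling_deviation {1..n} (w k) (set r)\<bar>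
          + \<bar>(real (card (set r)) - real n * p) / real n * (\<Sum>i=1..n. w k i)\<bar>"
        by (simp only: abs_triangle_ineq)
      also have "\<dots> = \<bar>sampling_deviation {1..n} (w k) (set r)\<bar> + Y r / real n * \<bar>\<Sum>i=1..n. w k i\<bar>"
        by (simp add: Y_def abs_mult)
      also have "\<dots> \<le> M r + Y r / real n * sqrt (real n)"
        unfolding M_def using k l1[OF w1[OF k]]
        by (intro add_mono Max_ge mult_left_mono) (auto simp: Y_def)
      also have "Y r / real n * sqrt (real n) = Y r / sqrt (real n)"
        using n0 by (simp add: real_div_sqrt field_simps)
      finally show ?thesis .
    qed
    have bounded_count: "\<bar>h (set r)\<bar> \<le> Max ((\<lambda>B. \<bar>h B\<bar>) ` Pow {1..n})" if "r \<in> set_pmf Q" for h :: "nat set \<Rightarrow> real" and r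
      using supp that by (intro Max_ge) (auto simp: seqs_def)
    have int_set: "integrable (measure_pmf Q) (\<lambda>r. h (set r))" for h :: "nat set \<Rightarrow> real"
      by (rule integrable_measure_pmf_bounded) (use bounded_count[of _ h] in simp)
    have int_M: "integrable (measure_pmf Q) M" and int_Y: "integrable (measure_pmf Q) Y"
      and int_X: "integrable (measure_pmf Q) (\<lambda>r. \<bar>X i r\<bar>)" for i
      unfolding M_def Y_def X_def
      using int_set[of "\<lambda>B. MAX k\<in>{1..K}. \<bar>sampling_deviation {1..n} (w k) B\<bar>"]
        int_set[of "\<lambda>B. \<bar>real (card B) - real n * p\<bar>"] int_set[of "\<lambda>B. \<bar>of_bool (i \<in> B) - p\<bar>"] by auto
    have int_Xg: "integrable (measure_pmf Q) (\<lambda>r. X i r *\<^sub>R (g r - w0))" for i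
    proof -
      have "integrable (measure_pmf Q) (\<lambda>r. X i r *\<^sub>R w0)"
        using X1 by (intro integrable_measure_pmf_bounded[where B="norm w0"]) (auto intro: mult_left_le_one_le)
      then show ?thesis using integrable_scaled[of "X i" 1] X1 by (simp add: scaleR_diff_right)
    qed
    have int_u: "integrable (measure_pmf Q) (\<lambda>r. a i * (X i r * u i (g r - w0)))" for i
      using integrable_bounded_linear[OF u(1)[of i] int_Xg[of i]]
      by (simp add: linear_scale[OF bounded_linear.linear[OF u(1)]])
    have "(1 - p) * N = (\<Sum>i=1..n. a i * ((1 - p) * norm (\<Delta> i)))"
    proof -
      have "(\<Sum>i=1..n. a i * ((1 - p) * norm (\<Delta> i))) = (1 - p) * (N\<^sup>2 / N)"
        unfolding N2 a_def by (simp add: sum_distrib_left sum_divide_distrib power2_eq_square mult_ac)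
      then show ?thesis using N by (simp add: power2_eq_square)
    qed
    also have "\<dots> = (\<Sum>i=1..n. E (\<lambda>r. a i * (X i r * u i (g r - w0))))"
    proof (intro sum.cong refl)
      fix i assume i: "i \<in> {1..n}"
      have "(1 - p) * norm (\<Delta> i) = u i ((1 - p) *\<^sub>R \<Delta> i)"
        by (simp add: linear_scale[OF bounded_linear.linear[OF u(1)]] u(2))
      also have "\<dots> = u i (E (\<lambda>r. X i r *\<^sub>R (g r - w0)))"
        by (simp add: \<Delta>_covariance[OF i, of w0] X_def)
      also have "\<dots> = E (\<lambda>r. u i (X i r *\<^sub>R (g r - w0)))"
        by (rule integral_bounded_linear[OF u(1) int_Xg, symmetric])
      finally show "a i * ((1 - p) * norm (\<Delta> i)) = E (\<lambda>r. a i * (X i r * u i (g r - w0)))"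
        by (simp add: linear_scale[OF bounded_linear.linear[OF u(1)]])
    qed
    also have "\<dots> = E (\<lambda>r. U r (g r - w0))"
      using int_u by (simp add: U_def mult.assoc)
    also have "\<dots> \<le> E (\<lambda>r. R * (M r + Y r / sqrt (real n)) + \<rho> * (\<Sum>i=1..n. a i * \<bar>X i r\<bar>))"
    proof (rule integral_measure_pmf_mono)
      show "integrable (measure_pmf Q) (\<lambda>r. U r (g r - w0))"
        unfolding U_def using int_u by (simp add: mult.assoc)
      show "integrable (measure_pmf Q) (\<lambda>r. R * (M r + Y r / sqrt (real n)) + \<rho> * (\<Sum>i=1..n. a i * \<bar>X i r\<bar>))"
        using int_M int_Y int_X by simp
    qed (intro approx U_lin U_norm U_v)
    also have "\<dots> = R * (E M + E Y / sqrt (real n)) + \<rho> * (\<Sum>i=1..n. a i * E (\<lambda>r. \<bar>X i r\<bar>))"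
      using int_M int_Y int_X by simp
    also have "(\<Sum>i=1..n. a i * E (\<lambda>r. \<bar>X i r\<bar>)) = (\<Sum>i=1..n. a i) * (2 * p * (1 - p))"
      unfolding X_def sum_distrib_right
      by (intro sum.cong refl arg_cong2[of _ _ _ _ "(*)"] expectation_abs_of_bool_centered E_mem) (use p0 p1 in auto)
    finally have "(1 - p) * N \<le> R * (E M + E Y / sqrt (real n)) + \<rho> * ((\<Sum>i=1..n. a i) * (2 * p * (1 - p)))" .
    also have "\<dots> \<le> R * (E M + sqrt (p * (1 - p))) + \<rho> * (sqrt (real n) * (2 * p * (1 - p)))"
    proof (intro add_mono mult_left_mono mult_right_mono order.refl R \<rho>)
      have "E Y \<le> sqrt (real n * (p * (1 - p)))"
        unfolding Y_def using n by (intro expectation_abs_centered_count_le supp sym cov p_def) simp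
      then show "E Y / sqrt (real n) \<le> sqrt (p * (1 - p))"
        using n0 by (simp only: real_sqrt_mult pos_divide_le_eq real_sqrt_gt_0_iff mult.commute)
      show "(\<Sum>i=1..n. a i) \<le> sqrt (real n)" using l1[of a] a1 by simp
    qed (use p p1 in simp)
    finally have main: "(1 - p) * N \<le> R * (E M + sqrt (p * (1 - p))) + \<rho> * (sqrt (real n) * (2 * p * (1 - p)))" .
    define G where "G = 16 / 5 * (1 + eta n) * L * (p * (1 - p) + 4 * eta n)"
    \<comment> \<open>\<open>G0\<close> is \<open>G\<close> with \<open>eta n\<close> replaced by
      0.\<close>
    define G0 where "G0 = 16 / 5 * L * (p * (1 - p))"
    have e: "eta n \<ge> 0" by (rule eta_lower_bound[OF n])
    have pq: "p * (1 - p) > 0" using p p1 by simp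
    have G0G: "G0 \<le> G"
    proof -
      have "1 * (p * (1 - p)) \<le> (1 + eta n) * (p * (1 - p) + 4 * eta n)"
        using e pq by (intro mult_mono) auto
      then have "16 / 5 * L * (p * (1 - p)) \<le> 16 / 5 * L * ((1 + eta n) * (p * (1 - p) + 4 * eta n))"
        using L by (intro mult_left_mono) auto
      then show ?thesis by (simp only: G_def G0_def mult_ac)
    qed
    have "(1 - p) * N \<le> R * (sqrt G + sqrt (p * (1 - p))) + \<rho> * (sqrt (real n) * (2 * p * (1 - p)))"
    \<comment> \<open>If this holds, the claim is immediate. Otherwise \<open>N\<close> is so large
      that \<open>a i\<close>, at most \<open>p * R / N\<close>, meets the size condition of the
      Bernstein bound.\<close>
    proof (cases "(1 - p) * N \<le> R * sqrt G0")
      case True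
      also have "R * sqrt G0 \<le> R * (sqrt G + sqrt (p * (1 - p)))"
        using G0G pq R real_sqrt_le_mono[OF G0G] by (intro mult_left_mono) (auto intro: add_increasing2)
      also have "\<dots> \<le> R * (sqrt G + sqrt (p * (1 - p))) + \<rho> * (sqrt (real n) * (2 * p * (1 - p)))"
        using \<rho> p p1 by simp
      finally show ?thesis .
    next
      case False
      have a_le: "a i \<le> sqrt (p * (1 - p) / (16 / 5 * L))" if "i \<in> {1..n}" for i
      proof -
        have "sqrt (p * (1 - p) / (16 / 5 * L)) * sqrt G0 = p * (1 - p)"
          using L pq unfolding G0_def real_sqrt_mult[symmetric] by (simp add: real_sqrt_mult[symmetric] real_sqrt_unique power2_eq_square del: real_sqrt_mult)
        moreover have "sqrt (p * (1 - p) / (16 / 5 * L)) * (R * sqrt G0)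
          \<le> sqrt (p * (1 - p) / (16 / 5 * L)) * ((1 - p) * N)"
          using False L pq by (intro mult_left_mono) auto
        ultimately have "(1 - p) * (p * R) \<le> (1 - p) * (sqrt (p * (1 - p) / (16 / 5 * L)) * N)"
          by (simp add: mult_ac)
        then have "p * R \<le> sqrt (p * (1 - p) / (16 / 5 * L)) * N" using p1 by simp
        with norm_\<Delta>_le[OF that] have "norm (\<Delta> i) \<le> sqrt (p * (1 - p) / (16 / 5 * L)) * N" by simp
        then show ?thesis using N by (simp add: a_def pos_divide_le_eq)
      qed
      have "E M \<le> sqrt (16 / 5 * (1 + eta n) * ln (2 * real (card {1..K})) * (p * (1 - p) + 4 * eta n))"
        unfolding M_def
      proof (rule symmetric_expected_max_deviation_le[OF n supp sym p_def p p1 _ _ w1])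
        fix k i assume "k \<in> {1..K}" "i \<in> {1..n}"
        then show "\<bar>w k i\<bar> \<le> sqrt (p * (1 - p) / (16 / 5 * ln (2 * real (card {1..K}))))"
          using wa[of k i] a_le[of i] by (simp add: L_def)
      qed (use K in auto)
      then have "E M \<le> sqrt G" by (simp add: G_def L_def)
      then have "R * (E M + sqrt (p * (1 - p))) \<le> R * (sqrt G + sqrt (p * (1 - p)))"
        using R by (intro mult_left_mono) auto
      then show ?thesis using main by linarith
    qed
    then have "N\<^sup>2 / real n \<le> 1.6 * (R * sqrt (2 * (1 + eta n) * L / real n * (p / (1 - p) + 4 * eta n / (1 - p)\<^sup>2))
      + R * sqrt (1 / real n * (p / (1 - p))) + 2 * \<rho> * p)\<^sup>2"
      unfolding G_def using n0 p0 p1 R \<rho> e L N0 by (intro stability_bound_arith) auto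
    then show ?thesis unfolding N2 L_def by simp
  qed
qed

end

section \<open>Bagging\<close>

lemma prob_space_unif01: "prob_space unif01"
  unfolding unif01_def by (intro prob_space_restrict_space) auto

lemma space_unif01: "space unif01 = {0..1}"
  by (simp add: unif01_def space_restrict_space)

lemma randomized_algorithmD:
  assumes "randomized_algorithm W A"
  shows "A D \<in> borel_measurable unif01" "\<xi> \<in> space unif01 \<Longrightarrow> A D \<xi> \<in> W"
proof -
  have m: "A D \<in> restrict_space borel {0..1} \<rightarrow>\<^sub>M restrict_space borel W"
    using assms by (simp add: randomized_algorithm_def)
  have "sets unif01 = sets (restrict_space borel {0..1})"
    unfolding unif01_def by (intro sets_restrict_space_cong) simp
  then show "A D \<in> borel_measurable unif01"
    using m by (simp add: measurable_restrict_space2_iff cong: measurable_cong_sets)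
  show "A D \<xi> \<in> W" if "\<xi> \<in> space unif01"
    using m that by (auto simp: measurable_restrict_space2_iff space_unif01 space_restrict_space)
qed

text \<open>Fubini's theorem. Measurability in the seed for each bag gives joint measurability
  because there are only countably many bags.\<close>

lemma integral_pair_pmf_unif01:
  fixes F :: "'a::countable \<Rightarrow> real \<Rightarrow> 'b::{banach, second_countable_topology}"
  assumes meas: "\<And>r. F r \<in> borel_measurable unif01"
    and bnd: "\<And>r \<xi>. \<xi> \<in> space unif01 \<Longrightarrow> norm (F r \<xi>) \<le> C"
  shows "(\<integral>(r, \<xi>). F r \<xi> \<partial>(measure_pmf Q \<Otimes>\<^sub>M unif01)) = measure_pmf.expectation Q (\<lambda>r. \<integral>\<xi>. F r \<xi> \<partial>unif01)"
proof -
  interpret U: prob_space unif01 by (rule prob_space_unif01)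
  interpret P: pair_prob_space "measure_pmf Q" unif01 ..
  have "(\<lambda>(r, \<xi>). F r \<xi>) \<in> borel_measurable (count_space UNIV \<Otimes>\<^sub>M unif01)"
    by (rule measurable_pair_measure_countable1) (use meas in auto)
  also have "borel_measurable (count_space UNIV \<Otimes>\<^sub>M unif01) = borel_measurable (measure_pmf Q \<Otimes>\<^sub>M unif01)"
    by (intro measurable_cong_sets sets_pair_measure_cong) auto
  finally have "integrable (measure_pmf Q \<Otimes>\<^sub>M unif01) (\<lambda>(r, \<xi>). F r \<xi>)"
    using bnd by (intro P.integrable_const_bound[where B=C]) (auto simp: space_pair_measure)
  from P.integral_fst'[OF this] show ?thesis by simp
qed

lemma integral_cond_pmf:
  fixes f :: "'a \<Rightarrow> 'b::{banach, second_countable_topology}"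
  assumes ne: "set_pmf Q \<inter> S \<noteq> {}"
  shows "measure_pmf.expectation (cond_pmf Q S) f
    = (1 / measure_pmf.prob Q S) *\<^sub>R measure_pmf.expectation Q (\<lambda>x. indicator S x *\<^sub>R f x)"
proof -
  have pos: "measure_pmf.prob Q S > 0"
    using measure_pmf_posI ne by (metis disjoint_iff)
  have "measure_pmf (cond_pmf Q S) = density (measure_pmf Q) (\<lambda>x. ennreal (indicator S x / measure_pmf.prob Q S))"
    unfolding cond_pmf.rep_eq[OF ne] uniform_measure_def measure_pmf.emeasure_eq_measure
    using pos by (intro arg_cong[of _ _ "density (measure_pmf Q)"] ext)
      (auto simp: divide_ennreal ennreal_1[symmetric] split: split_indicator simp del: ennreal_1)
  then have "measure_pmf.expectation (cond_pmf Q S) f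
    = measure_pmf.expectation Q (\<lambda>x. (indicator S x / measure_pmf.prob Q S) *\<^sub>R f x)"
    by (simp add: integral_density)
  also have "\<dots> = measure_pmf.expectation Q (\<lambda>x. (1 / measure_pmf.prob Q S) *\<^sub>R (indicator S x *\<^sub>R f x))"
    by (intro Bochner_Integration.integral_cong) auto
  finally show ?thesis by (simp only: integral_scaleR_right)
qed

text \<open>A permutation of \<open>{1..n}\<close> that maps the indices of \<open>leave_out D i\<close> to those of \<open>D\<close>; the excluded
  index \<open>n\<close> goes to \<open>i\<close>.\<close>

definition loo_index :: "nat \<Rightarrow> nat \<Rightarrow> nat \<Rightarrow> nat" where
  "loo_index n i j = (if j < i then j else if j < n then Suc j else if j = n then i else j)"

lemma loo_index_permutes:
  assumes "i \<in> {1..n}"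
  shows "loo_index n i permutes {1..n}"
proof (rule bij_imp_permutes)
  have "inj_on (loo_index n i) {1..n}"
    using assms by (auto simp: inj_on_def loo_index_def split: if_splits)
  moreover have "loo_index n i ` {1..n} \<subseteq> {1..n}"
    using assms by (auto simp: loo_index_def)
  ultimately show "bij_betw (loo_index n i) {1..n} {1..n}"
    by (simp add: bij_betw_def endo_inj_surj)
  show "loo_index n i j = j" if "j \<notin> {1..n}" for j
    using that assms by (auto simp: loo_index_def)
qed

lemma bag_leave_out:
  assumes i: "i \<in> {1..n}" and D: "length D = n" and r: "r \<in> seqs (n - 1)"
  shows "bag (leave_out D i) r = bag D (map (loo_index n i) r)"
proof -
  have "leave_out D i ! (j - 1) = D ! (loo_index n i j - 1)" if j: "j \<in> {1..n - 1}" for j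
  proof (cases "j < i")
    case True
    then show ?thesis using i j D by (auto simp: leave_out_def loo_index_def nth_append)
  next
    case False
    \<comment> \<open>Position \<open>j - 1\<close> of the shortened list lies in
      \<open>drop i D\<close> at offset \<open>j - i\<close>. The entry is therefore
      \<open>D ! j\<close>, the data point with index \<open>Suc j\<close>.\<close>
    then have "i + (j - i) = j" by simp
    then show ?thesis using False i j D by (auto simp: leave_out_def loo_index_def nth_append)
  qed
  then show ?thesis using r by (auto simp: bag_def seqs_def)
qed

text \<open>Relabelling by \<open>loo_index n i\<close> turns the event that \<open>n\<close> is
  absent into the event that \<open>i\<close> is absent, and by symmetry it preserves
  \<open>Q\<close>. Compatibility is stated for the last index only; this carries it over to every
  index.\<close>

lemma (in resampled_mean) expectation_leave_one_out:
  assumes i: "i \<in> {1..n}" and loo: "leave_one_out_compatible n Q Q'"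
  shows "measure_pmf.expectation Q' (\<lambda>r. g (map (loo_index n i) r)) = loo_mean i"
proof -
  let ?\<sigma> = "loo_index n i"
  define S where "S = {r :: nat list. n \<notin> set r}"
  have \<sigma>: "?\<sigma> permutes {1..n}" by (rule loo_index_permutes[OF i])
  have \<sigma>n: "?\<sigma> n = i" using i by (auto simp: loo_index_def)
  have nS: "n \<in> {1..n}" using n by simp
  have prob: "measure_pmf.prob Q S = 1 - p"
  proof -
    have "measure_pmf.prob Q S = E (indicator S)" by simp
    also have "\<dots> = E (\<lambda>r. 1 - of_bool (n \<in> set r))"
      by (intro Bochner_Integration.integral_cong) (auto simp: S_def)
    also have "\<dots> = 1 - p" using E_mem[OF nS] by (simp add: integrable_measure_pmf_of_bool)
    finally show ?thesis .
  qed
  have ne: "set_pmf Q \<inter> S \<noteq> {}"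
    using prob p1 measure_pmf_zero_iff[of Q S] by auto
  have "measure_pmf.expectation Q' (\<lambda>r. g (map ?\<sigma> r)) = (1 / (1 - p)) *\<^sub>R E (\<lambda>r. indicator S r *\<^sub>R g (map ?\<sigma> r))"
    using loo unfolding leave_one_out_compatible_def S_def[symmetric]
    by (simp add: integral_cond_pmf[OF ne] prob)
  also have "E (\<lambda>r. indicator S r *\<^sub>R g (map ?\<sigma> r)) = E (\<lambda>r. of_bool (i \<notin> set (map ?\<sigma> r)) *\<^sub>R g (map ?\<sigma> r))"
  proof (intro Bochner_Integration.integral_cong refl)
    fix r
    have "?\<sigma> n \<in> ?\<sigma> ` set r \<longleftrightarrow> n \<in> set r"
      by (rule inj_image_mem_iff[OF permutes_inj[OF \<sigma>]])
    then have "i \<in> set (map ?\<sigma> r) \<longleftrightarrow> n \<in> set r" by (simp only: set_map \<sigma>n)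
    then show "indicator S r *\<^sub>R g (map ?\<sigma> r) = of_bool (i \<notin> set (map ?\<sigma> r)) *\<^sub>R g (map ?\<sigma> r)"
      by (simp add: S_def)
  qed
  also have "\<dots> = E (\<lambda>r. of_bool (i \<notin> set r) *\<^sub>R g r)"
    by (rule expectation_permutation[OF supp sym \<sigma>])
  finally show ?thesis by (simp add: loo_mean_def)
qed

text \<open>The approximation error costs at most \<open>\<rho> * B\<close>; on the combination of
  the \<open>v i\<close>, Hoelder's inequality for the l1 and maximum norms gives
  \<open>R * M\<close>. This is what supplies \<open>approx\<close> in
  \<open>mean_square_\<Delta>_le\<close>.\<close>

lemma functional_le_of_l1_approximation:
  fixes u :: "'b::real_normed_vector \<Rightarrow> real" and v :: "nat \<Rightarrow> 'b"
  assumes u: "bounded_linear u" "\<And>x. \<bar>u x\<bar> \<le> B * norm x" and uv: "\<And>k. k \<in> {1..K} \<Longrightarrow> \<bar>u (v k)\<bar> \<le> M"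
    and B: "B \<ge> 0" and M: "M \<ge> 0" and t: "(\<Sum>i=1..K. \<bar>t i\<bar>) \<le> R"
    and x: "norm (x - (\<Sum>i=1..K. t i *\<^sub>R v i)) \<le> \<rho>"
  shows "u x \<le> R * M + \<rho> * B"
proof -
  interpret bounded_linear u by (rule u(1))
  define y where "y = (\<Sum>i=1..K. t i *\<^sub>R v i)"
  have "u x = u (x - y) + u y" by (simp add: diff)
  moreover have "u (x - y) \<le> \<rho> * B"
  proof -
    have "u (x - y) \<le> B * norm (x - y)" using u(2)[of "x - y"] by linarith
    also have "\<dots> \<le> B * \<rho>" unfolding y_def by (rule mult_left_mono[OF x B])
    finally show ?thesis by (simp add: mult.commute)
  qed
  moreover have "u y \<le> R * M"
  proof -
    have "u y = (\<Sum>i=1..K. t i * u (v i))" by (simp add: y_def sum scaleR)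
    also have "\<dots> \<le> (\<Sum>i=1..K. \<bar>t i\<bar> * M)"
    proof (rule sum_mono)
      fix i assume "i \<in> {1..K}"
      have "t i * u (v i) \<le> \<bar>t i\<bar> * \<bar>u (v i)\<bar>" by (simp add: abs_mult[symmetric])
      also have "\<dots> \<le> \<bar>t i\<bar> * M" by (intro mult_left_mono uv) (fact, simp)
      finally show "t i * u (v i) \<le> \<bar>t i\<bar> * M" .
    qed
    also have "\<dots> = (\<Sum>i=1..K. \<bar>t i\<bar>) * M" by (rule sum_distrib_right[symmetric])
    also have "\<dots> \<le> R * M" by (rule mult_right_mono[OF t M])
    finally show ?thesis .
  qed
  ultimately show ?thesis by linarith
qed

theorem theorem10:
  fixes n K :: nat
    and W :: "'b::{banach, second_countable_topology} set"
    and R \<rho> p :: real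
    and v :: "nat \<Rightarrow> 'b"
    and A :: "'z list \<Rightarrow> real \<Rightarrow> 'b"
    and Q :: "nat \<Rightarrow> nat list pmf"
  assumes "n \<ge> 2"
    and "W \<noteq> {}" "convex W" "closed W"
    and "K \<ge> 1" "R \<ge> 0" "\<rho> \<ge> 0"
    and "\<forall>w\<in>W. \<forall>w'\<in>W. norm (w - w') \<le> R"
    and "\<forall>i\<in>{1..K}. norm (v i) = 1"
    and "\<forall>w\<in>W. \<forall>w'\<in>W. \<exists>t :: nat \<Rightarrow> real.
           (\<Sum>i=1..K. \<bar>t i\<bar>) \<le> R \<and> norm ((w - w') - (\<Sum>i=1..K. t i *\<^sub>R v i)) \<le> \<rho>"
    and "randomized_algorithm W A"
    and "set_pmf (Q n) \<subseteq> seqs n" "set_pmf (Q (n - 1)) \<subseteq> seqs (n - 1)"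
    and "symmetric_resampling n (Q n)"
    and "p = inclusion_prob n (Q n)" "p < 1"
    and "nonpositive_covariance n (Q n)"
    and "leave_one_out_compatible n (Q n) (Q (n - 1))"
  shows "mean_square_stability n (derandomized_bagging A Q)
           (1.6 * (R * sqrt (2 * (1 + eta n) * ln (2 * real K) / real n
                               * (p / (1 - p) + 4 * eta n / (1 - p)\<^sup>2))
                   + R * sqrt (1 / real n * (p / (1 - p)))
                   + 2 * \<rho> * p)\<^sup>2)"
proof -
  note W = \<open>W \<noteq> {}\<close> and K = \<open>K \<ge> 1\<close> and R = \<open>R \<ge> 0\<close> and \<rho> = \<open>\<rho> \<ge> 0\<close> and n = \<open>n \<ge> 2\<close>
    and diamW = \<open>\<forall>w\<in>W. \<forall>w'\<in>W. norm (w - w') \<le> R\<close>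
    and alg = \<open>randomized_algorithm W A\<close>
  interpret U: prob_space unif01 by (rule prob_space_unif01)
  obtain w0 where w0: "w0 \<in> W" using W by auto
  have bndW: "norm w \<le> R + norm w0" if "w \<in> W" for w
    using diamW that w0 norm_triangle_sub[of w w0] by fastforce
  have int: "integrable unif01 (A D)" for D
    using bndW randomized_algorithmD[OF alg] by (intro U.integrable_const_bound[where B="R + norm w0"]) auto
  define h where "h D = (\<integral>\<xi>. A D \<xi> \<partial>unif01)" for D
  \<comment> \<open>Applied twice, first with \<open>y\<close> in \<open>W\<close> and then with
    \<open>y\<close> the mean of another bag, this bounds the distance of two means.\<close>
  have near: "norm (h D - y) \<le> R" if "\<And>\<xi>. \<xi> \<in> space unif01 \<Longrightarrow> norm (A D \<xi> - y) \<le> R" for D y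
  proof -
    have "h D - y = (\<integral>\<xi>. A D \<xi> - y \<partial>unif01)" using int by (simp add: h_def U.prob_space)
    also have "norm \<dots> \<le> (\<integral>\<xi>. norm (A D \<xi> - y) \<partial>unif01)" by (rule integral_norm_bound)
    also have "\<dots> \<le> (\<integral>\<xi>. R \<partial>unif01)" using int that by (intro integral_mono) auto
    finally show ?thesis by (simp add: U.prob_space)
  qed
  have nearW: "norm (h D - y) \<le> R" if "y \<in> W" for D y
    using diamW that randomized_algorithmD(2)[OF alg] by (intro near) auto
  have diam: "norm (h D - h D') \<le> R" for D D'
    using nearW[OF randomized_algorithmD(2)[OF alg]] by (intro near) (simp add: norm_minus_commute)
  have bagging: "derandomized_bagging A Q D \<xi> = measure_pmf.expectation (Q (length D)) (\<lambda>r. h (bag D r))" for D \<xi>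
    unfolding derandomized_bagging_def h_def
    using bndW randomized_algorithmD[OF alg] by (intro integral_pair_pmf_unif01[where C="R + norm w0"]) auto
  show ?thesis
    unfolding mean_square_stability_def
  proof (intro allI impI)
    fix D :: "'z list" assume D: "length D = n"
    interpret resampled_mean n "Q n" p "\<lambda>r. h (bag D r)" R
      by unfold_locales (fact | rule diam)+
    have loo: "measure_pmf.expectation (Q (n - 1)) (\<lambda>r. h (bag (leave_out D i) r)) = loo_mean i"
      if i: "i \<in> {1..n}" for i
    proof -
      have "measure_pmf.expectation (Q (n - 1)) (\<lambda>r. h (bag (leave_out D i) r))
        = measure_pmf.expectation (Q (n - 1)) (\<lambda>r. h (bag D (map (loo_index n i) r)))"
        using assms(13) bag_leave_out[OF i D] by (intro integral_cong_AE) (auto simp: AE_measure_pmf_iff)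
      then show ?thesis using expectation_leave_one_out[OF i assms(18)] by simp
    qed
    have diff: "derandomized_bagging A Q D \<xi> - derandomized_bagging A Q (leave_out D i) \<xi> = \<Delta> i"
      if i: "i \<in> {1..n}" for i \<xi>
    proof -
      have "length (leave_out D i) = n - 1" using i D by (auto simp: leave_out_def)
      then show ?thesis using loo[OF i] by (simp add: bagging D \<Delta>_def)
    qed
    have "1 / real n * (\<Sum>i=1..n. (norm (\<Delta> i))\<^sup>2)
      \<le> 1.6 * (R * sqrt (2 * (1 + eta n) * ln (2 * real K) / real n
                               * (p / (1 - p) + 4 * eta n / (1 - p)\<^sup>2))
                   + R * sqrt (1 / real n * (p / (1 - p))) + 2 * \<rho> * p)\<^sup>2"
    proof (rule mean_square_\<Delta>_le[OF K R \<rho>, of v w0])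
      show "norm (v k) = 1" if "k \<in> {1..K}" for k using assms(9) that by blast
      fix u :: "'b \<Rightarrow> real" and B M r
      assume u: "bounded_linear u" "\<And>x. \<bar>u x\<bar> \<le> B * norm x" and uv: "\<And>k. k \<in> {1..K} \<Longrightarrow> \<bar>u (v k)\<bar> \<le> M"
      have "norm (v 1) = 1" using assms(9) K by auto
      then have B: "B \<ge> 0" using u(2)[of "v 1"] by simp
      have M: "M \<ge> 0" using uv[of 1] K by simp
      \<comment> \<open>The coefficients \<open>t\<close> depend on the seed, but they disappear
        from this bound, so it can be integrated over the seed without any measurable choice of
        them.\<close>
      have pt: "u (A (bag D r) \<xi> - w0) \<le> R * M + \<rho> * B" if \<xi>: "\<xi> \<in> space unif01" for \<xi>
      proof -
        obtain t :: "nat \<Rightarrow> real" where t: "(\<Sum>i=1..K. \<bar>t i\<bar>) \<le> R"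
          "norm ((A (bag D r) \<xi> - w0) - (\<Sum>i=1..K. t i *\<^sub>R v i)) \<le> \<rho>"
          using assms(10) randomized_algorithmD(2)[OF alg \<xi>] w0 by blast
        show ?thesis
          by (rule functional_le_of_l1_approximation[OF u(1) _ _ B M t]) (rule u(2), erule uv)
      qed
      have int_diff: "integrable unif01 (\<lambda>\<xi>. A (bag D r) \<xi> - w0)" using int by simp
      have "h (bag D r) - w0 = (\<integral>\<xi>. A (bag D r) \<xi> - w0 \<partial>unif01)"
        using int by (simp add: h_def U.prob_space)
      then have "u (h (bag D r) - w0) = (\<integral>\<xi>. u (A (bag D r) \<xi> - w0) \<partial>unif01)"
        by (simp only: integral_bounded_linear[OF u(1) int_diff])
      also have "\<dots> \<le> (\<integral>\<xi>. R * M + \<rho> * B \<partial>unif01)"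
        by (rule integral_mono[OF integrable_bounded_linear[OF u(1) int_diff] _ pt]) simp_all
      finally show "u (h (bag D r) - w0) \<le> R * M + \<rho> * B" by (simp add: U.prob_space)
    qed
    moreover have "(\<Sum>i=1..n. \<integral>\<^sup>+\<xi>. ennreal ((norm (derandomized_bagging A Q D \<xi> -
        derandomized_bagging A Q (leave_out D i) \<xi>))\<^sup>2) \<partial>unif01) = ennreal (\<Sum>i=1..n. (norm (\<Delta> i))\<^sup>2)"
    proof -
      have "(\<integral>\<^sup>+\<xi>. ennreal ((norm (derandomized_bagging A Q D \<xi> -
        derandomized_bagging A Q (leave_out D i) \<xi>))\<^sup>2) \<partial>unif01) = ennreal ((norm (\<Delta> i))\<^sup>2)"
        if "i \<in> {1..n}" for i
        unfolding diff[OF that] by (simp add: U.emeasure_space_1)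
      then show ?thesis by (simp only: sum_ennreal zero_le_power2 cong: sum.cong)
    qed
    moreover have "0 \<le> 1 / real n" by simp
    ultimately show "ennreal (1 / real n) * (\<Sum>i=1..n. \<integral>\<^sup>+\<xi>. ennreal ((norm (derandomized_bagging A Q D \<xi> -
        derandomized_bagging A Q (leave_out D i) \<xi>))\<^sup>2) \<partial>unif01)
      \<le> ennreal (1.6 * (R * sqrt (2 * (1 + eta n) * ln (2 * real K) / real n
                               * (p / (1 - p) + 4 * eta n / (1 - p)\<^sup>2))
                   + R * sqrt (1 / real n * (p / (1 - p))) + 2 * \<rho> * p)\<^sup>2)"
      by (simp only: ennreal_mult'[symmetric] ennreal_leI)
  qed
qed

end
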